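(* Let $T>0$, let $b:[0,T]\times\mathbb{R}^d\to\mathbb{R}^d$ be measurable, and suppose there are nonnegative $C_0,C_1\in L^1([0,T])$ such that for all $t\in[0,T]$ and $x,y\in\mathbb{R}^d$, $|b(t,x)|\le C_0(t)(1+|x|)$ and $(b(t,x)-b(t,y))\cdot(x-y)\ge -C_1(t)|x-y|^2$. Let $\phi_{t,s}$, $0\le t\le s\le T$, be the backward Filippov flow of $b$. Then for all $0\le t\le s\le T$ there exists a set $A_{ts}\subset\mathbb{R}^d$ of full Lebesgue measure such that, for all $y\in A_{ts}$, $\phi_{t,s}^{-1}(\{y\})$ is a singleton, denoted by $\{\phi_{s,t}(y)\}$. Moreover, there exists a version of the map $\phi_{s,t}:\mathbb{R}^d\to\mathbb{R}^d$ (i.e. a map defined on all of $\mathbb{R}^d$ and equal almost everywhere to the one just defined) that is continuous at almost every point of $\mathbb{R}^d$.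
   Context: Backward Filippov flow: let $\hat b(t,x)$ denote the convex hull of all limit points of $b(t,y)$ as $y\to x$. For every $(s,x)\in[0,T]\times\mathbb{R}^d$ there is a unique absolutely continuous $[0,s]\ni t\mapsto\phi_{t,s}(x)$ with $\partial_t\phi_{t,s}(x)\in\hat b(t,\phi_{t,s}(x))$ for a.e. $t\in[0,s]$ and $\phi_{s,s}(x)=x$. The map $\phi_{t,s}:\mathbb{R}^d\to\mathbb{R}^d$ is Lipschitz for $0\le t\le s\le T$. *)

theory Defs
  imports "HOL-Analysis.Analysis"
begin

definition abs_continuous_on ::
    "real \<Rightarrow> real \<Rightarrow> (real \<Rightarrow> 'a::real_normed_vector) \<Rightarrow> bool" where
  "abs_continuous_on a b f \<longleftrightarrow>
     (\<forall>\<epsilon>>0. \<exists>\<delta>>0. \<forall>D. finite D \<longrightarrow>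
        (\<forall>(u, v)\<in>D. a \<le> u \<and> u \<le> v \<and> v \<le> b) \<longrightarrow>
        pairwise (\<lambda>(u, v) (u', v'). {u<..<v} \<inter> {u'<..<v'} = {}) D \<longrightarrow>
        (\<Sum>(u, v)\<in>D. v - u) < \<delta> \<longrightarrow>
        (\<Sum>(u, v)\<in>D. norm (f v - f u)) < \<epsilon>)"

(* Limit points are taken as y tends to x with y different from x. *)
definition limit_points_at ::
    "('a::topological_space \<Rightarrow> 'b::topological_space) \<Rightarrow> 'a \<Rightarrow> 'b set" where
  "limit_points_at g x =
     {v. \<exists>y. filterlim y (at x) sequentially \<and> (\<lambda>n. g (y n)) \<longlonglongrightarrow> v}"

definition filippov_hull ::
    "(real \<Rightarrow> 'a::real_normed_vector \<Rightarrow> 'a) \<Rightarrow> real \<Rightarrow> 'a \<Rightarrow> 'a set" where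
  "filippov_hull b t x = convex hull (limit_points_at (b t) x)"

definition backward_filippov_solution ::
    "(real \<Rightarrow> 'a::real_normed_vector \<Rightarrow> 'a) \<Rightarrow> real \<Rightarrow> 'a \<Rightarrow> (real \<Rightarrow> 'a) \<Rightarrow> bool" where
  "backward_filippov_solution b s x \<gamma> \<longleftrightarrow>
     abs_continuous_on 0 s \<gamma> \<and> \<gamma> s = x \<and>
     (AE t in lebesgue_on {0..s}.
        \<exists>v\<in>filippov_hull b t (\<gamma> t). (\<gamma> has_vector_derivative v) (at t within {0..s}))"

(* \<phi> t s x stands for \<phi>_{t,s}(x) and is only constrained for 0 \<le> t \<le> s \<le> T.
   Solutions are unique on {0..s} under the one-sided Lipschitz condition on b, so that
   condition determines \<phi> on this range; uniqueness is therefore not required here. *)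
definition backward_filippov_flow ::
    "real \<Rightarrow> (real \<Rightarrow> 'a::real_normed_vector \<Rightarrow> 'a) \<Rightarrow> (real \<Rightarrow> real \<Rightarrow> 'a \<Rightarrow> 'a) \<Rightarrow> bool" where
  "backward_filippov_flow T b \<phi> \<longleftrightarrow>
     (\<forall>s\<in>{0..T}. \<forall>x. backward_filippov_solution b s x (\<lambda>t. \<phi> t s x))"

end

theory Submission
  imports Defs
begin

text \<open>
  Fix \<open>t \<le> s\<close> and let \<open>\<Phi> = \<phi> t s\<close> be the backward flow map. By the growth bound, \<open>\<Phi>\<close> is proper.
  The statement follows from three further properties of \<open>\<Phi>\<close>: it is Lipschitz and onto, and each
  of its fibers is connected.

  Connected fibers make non-injectivity negligible. If a connected fiber contains two points, some
  coordinate takes a whole interval of values on it, hence a rational value. So the points with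
  more than one preimage lie in the union of the images under \<open>\<Phi>\<close> of the countably many
  hyperplanes \<open>x \<bullet> k = q\<close> with \<open>q\<close> rational, and a Lipschitz map sends null sets to null sets
  (\<open>negligible_nonsingleton_fibers\<close>). Continuity then comes for free: \<open>\<Phi>\<close> is proper, so the
  multivalued inverse is upper semicontinuous, and every section of \<open>\<Phi>\<close> is continuous at each
  point over which the fiber is a singleton (\<open>isCont_section_at_singleton_fiber\<close>).

  Connectedness comes from approximation. If \<open>\<Phi>\<close> is a locally uniform limit of homeomorphisms of
  the whole space, a splitting of a fiber into two compact pieces would split the preimage of a
  small ball under a homeomorphism, which is impossible (\<open>connected_fiber_of_approximable\<close>). The
  same idea, with a larger ball, shows that a proper such map is onto (\<open>surj_of_approximable\<close>).

  The homeomorphisms are explicit Euler schemes run backward in time. Freeze the space variable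
  during a step, and replace \<open>b r x\<close> by a finite average of values \<open>b r z\<close> at nodes \<open>z\<close> near \<open>x\<close>,
  with weights that are Lipschitz in \<open>x\<close>. A short step is then a small Lipschitz perturbation of
  the identity, hence a homeomorphism. No modulus of continuity of \<open>b\<close> enters the error estimate:
  for a velocity \<open>v\<close> of the exact curve at the point \<open>c\<close>, the one-sided condition gives
  \<open>(v - b r z) \<bullet> (c - z) \<ge> - C r * |c - z|\<^sup>2\<close> for every node separately, and moving \<open>z\<close> to the
  current point of the scheme costs only a multiple of the small distance between them
  (\<open>one_sided_estimate\<close>, \<open>euler_step_error\<close>). The estimate also compares an exact curve with an
  Euler curve from a different starting point, and letting its error term tend to zero
  yields the Lipschitz bound for \<open>\<Phi>\<close> (\<open>ae_continuous_inverse\<close>).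

  Curves are handled in integral form throughout. An absolutely continuous curve that is
  differentiable almost everywhere is recovered from its derivative as a gauge integral, without
  prior knowledge that the derivative is measurable (\<open>abs_continuous_on_FTC\<close>), and the squared
  distance of two indefinite integrals is estimated directly on short intervals
  (\<open>energy_inequality\<close>).
\<close>

section \<open>Absolutely continuous curves\<close>

text \<open>
  In a sufficiently fine tagged division the intervals fall into two groups. For tags outside the
  null set \<open>N\<close> the increment of \<open>f\<close> agrees with the derivative times the length, up to a small
  multiple of the length. The intervals with tags in \<open>N\<close> have small total length, so the increments
  of \<open>f\<close> over them are small by absolute continuity. The increments telescope to \<open>f b - f a\<close>.
\<close>
lemma abs_continuous_on_FTC:
  fixes f :: "real \<Rightarrow> 'a::banach"
  assumes "a \<le> b" and ac: "abs_continuous_on a b f" and "negligible N"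
    and deriv: "\<And>t. t \<in> {a..b} - N \<Longrightarrow> (f has_vector_derivative f' t) (at t within {a..b})"
  shows "(f' has_integral (f b - f a)) {a..b}"
proof -
  define h where "h t = (if t \<in> N then 0 else f' t)" for t
  have "(h has_integral (f b - f a)) {a..b}"
    unfolding has_integral_real
  proof (intro allI impI)
    fix e :: real assume "e > 0"
    define e1 where "e1 = e / (4 * (1 + (b - a)))"
    have "e1 > 0" using \<open>e > 0\<close> \<open>a \<le> b\<close> by (auto simp: e1_def)
    have e1: "e1 * (b - a) \<le> e / 4"
      using \<open>e > 0\<close> \<open>a \<le> b\<close> by (auto simp: e1_def field_simps)
    obtain \<delta> where "\<delta> > 0" and \<delta>: "\<And>D. finite D \<Longrightarrow> (\<forall>(u, v)\<in>D. a \<le> u \<and> u \<le> v \<and> v \<le> b) \<Longrightarrow>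
        pairwise (\<lambda>(u, v) (u', v'). {u<..<v} \<inter> {u'<..<v'} = {}) D \<Longrightarrow>
        (\<Sum>(u, v)\<in>D. v - u) < \<delta> \<Longrightarrow> (\<Sum>(u, v)\<in>D. norm (f v - f u)) < e / 4"
    proof -
      have "e / 4 > 0" using \<open>e > 0\<close> by simp
      from ac[unfolded abs_continuous_on_def, THEN spec, THEN mp, OF this] that show thesis by blast
    qed
    have "\<forall>t. \<exists>d>0. t \<in> {a..b} - N \<longrightarrow>
         (\<forall>y\<in>{a..b}. norm (y-t) < d \<longrightarrow> norm (f y - f t - (y-t) *\<^sub>R f' t) \<le> e1 * norm (y-t))"
      using deriv[unfolded has_vector_derivative_def has_derivative_within_alt] \<open>e1 > 0\<close>
      by (meson zero_less_one)
    then obtain d where d: "\<And>t. 0 < d t"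
      "\<And>t y. \<lbrakk>t \<in> {a..b} - N; y \<in> {a..b}; norm (y-t) < d t\<rbrakk>
                        \<Longrightarrow> norm (f y - f t - (y-t) *\<^sub>R f' t) \<le> e1 * norm (y-t)"
      by metis
    \<comment> \<open>A gauge adapted to the indicator of \<open>N\<close> bounds the total length of the intervals tagged in \<open>N\<close>.\<close>
    have N0: "(indicator N has_integral (0::real)) {a..b}"
      using \<open>negligible N\<close> unfolding negligible_def box_real(2)[symmetric] by blast
    have "\<exists>g. gauge g \<and> (\<forall>\<D>. \<D> tagged_division_of {a..b} \<and> g fine \<D> \<longrightarrow>
        norm ((\<Sum>(x,k)\<in>\<D>. measure lborel k *\<^sub>R (indicator N x :: real)) - 0) < \<delta>)"
      by (rule has_integral_real[THEN iffD1, OF N0, THEN spec, THEN mp, OF \<open>\<delta> > 0\<close>])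
    then obtain g where "gauge g" and g: "\<forall>\<D>. \<D> tagged_division_of {a..b} \<and> g fine \<D> \<longrightarrow>
        norm ((\<Sum>(x,k)\<in>\<D>. measure lborel k *\<^sub>R (indicator N x :: real)) - 0) < \<delta>"
      by (elim exE conjE)
    let ?g = "\<lambda>x. ball x (d x) \<inter> g x"
    show "\<exists>\<gamma>. gauge \<gamma> \<and> (\<forall>\<D>. \<D> tagged_division_of {a..b} \<and> \<gamma> fine \<D> \<longrightarrow>
        norm ((\<Sum>(x,k)\<in>\<D>. measure lborel k *\<^sub>R h x) - (f b - f a)) < e)"
    proof (intro exI[of _ ?g] conjI allI impI)
      show "gauge ?g" using d(1) \<open>gauge g\<close> by (intro gauge_Int gauge_ball_dependent) auto
      fix \<D> assume "\<D> tagged_division_of {a..b} \<and> ?g fine \<D>"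
      then have D: "\<D> tagged_division_of {a..b}" and "(\<lambda>x. ball x (d x)) fine \<D>" "g fine \<D>"
        by (auto simp: fine_Int)
      have "finite \<D>" using tagged_division_ofD(1)[OF D] .
      have K: "\<exists>u v. K = {u..v} \<and> u \<le> v \<and> x \<in> {u..v} \<and> a \<le> u \<and> v \<le> b \<and> Inf K = u \<and> Sup K = v \<and> measure lborel K = v - u"
        if xK: "(x,K) \<in> \<D>" for x K
      proof -
        have "x \<in> K" "K \<subseteq> {a..b}" using tagged_division_ofD(2,3)[OF D xK] .
        moreover obtain u v where "K = {u..v}"
          using tagged_division_ofD(4)[OF D xK] unfolding box_real(2) by blast
        ultimately have "K = {u..v} \<and> u \<le> v \<and> x \<in> {u..v} \<and> a \<le> u \<and> v \<le> b" by auto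
        then show ?thesis by (intro exI[of _ u] exI[of _ v]) simp
      qed
      define B where "B = {(x,K)\<in>\<D>. x \<in> N}"
      have "B \<subseteq> \<D>" "finite B" using \<open>finite \<D>\<close> by (auto simp: B_def intro: finite_subset)
      let ?p = "\<lambda>(x::real,K::real set). (Inf K, Sup K)"
      have disj: "interior K1 \<inter> interior K2 = {}"
        if "(x1,K1) \<in> \<D>" "(x2,K2) \<in> \<D>" "(x1,K1) \<noteq> (x2,K2)" for x1 K1 x2 K2
        using tagged_division_ofD(5)[OF D] that by blast
      have inj: "inj_on ?p B"
      proof (rule inj_onI, clarify)
        fix x1 K1 x2 K2 assume B: "(x1,K1) \<in> B" "(x2,K2) \<in> B" and eq: "Inf K1 = Inf K2" "Sup K1 = Sup K2"
        then have m: "(x1,K1) \<in> \<D>" "(x2,K2) \<in> \<D>" by (auto simp: B_def)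
        from K[OF m(1)] K[OF m(2)] eq obtain u v where
          uv: "K1 = {u..v}" "K2 = {u..v}" "u \<le> v" "x1 \<in> {u..v}" "x2 \<in> {u..v}" by auto
        show "x1 = x2 \<and> K1 = K2"
        proof (rule ccontr)
          assume ne: "\<not> (x1 = x2 \<and> K1 = K2)"
          then have "interior K1 \<inter> interior K2 = {}" using disj[OF m] by auto
          then have "u = v" using uv by (auto simp: interior_atLeastAtMost_real not_less)
          then show False using uv ne by auto
        qed
      qed
      have bad: "(\<Sum>(x,K)\<in>B. norm (f (Sup K) - f (Inf K))) < e / 4"
      proof -
        have "(\<Sum>(u, v)\<in>?p ` B. norm (f v - f u)) < e / 4"
        proof (rule \<delta>)
          show "finite (?p ` B)" using \<open>finite B\<close> by auto
          show "\<forall>(u, v)\<in>?p ` B. a \<le> u \<and> u \<le> v \<and> v \<le> b"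
            using K \<open>B \<subseteq> \<D>\<close> by fastforce
          show "pairwise (\<lambda>(u, v) (u', v'). {u<..<v} \<inter> {u'<..<v'} = {}) (?p ` B)"
          proof (rule pairwiseI)
            fix P Q assume "P \<in> ?p ` B" "Q \<in> ?p ` B" and ne: "P \<noteq> Q"
            then obtain x1 K1 x2 K2 where PQ: "P = (Inf K1, Sup K1)" "Q = (Inf K2, Sup K2)"
              and B: "(x1,K1) \<in> B" "(x2,K2) \<in> B" by auto
            then have m: "(x1,K1) \<in> \<D>" "(x2,K2) \<in> \<D>" "(x1,K1) \<noteq> (x2,K2)"
              using ne by (auto simp: B_def)
            from K[OF m(1)] K[OF m(2)] have "interior K1 = {Inf K1<..<Sup K1}" "interior K2 = {Inf K2<..<Sup K2}"
              by (metis interior_atLeastAtMost_real)+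
            with disj[OF m] show "(case P of (u, v) \<Rightarrow> \<lambda>(u', v'). {u<..<v} \<inter> {u'<..<v'} = {}) Q"
              by (simp add: PQ)
          qed
          have "(\<Sum>(u, v)\<in>?p ` B. v - u) = (\<Sum>(x,K)\<in>B. Sup K - Inf K)"
            by (subst sum.reindex[OF inj]) (auto simp: case_prod_unfold)
          also have "\<dots> = (\<Sum>(x,K)\<in>B. measure lborel K *\<^sub>R (indicator N x::real))"
            using K \<open>B \<subseteq> \<D>\<close> by (intro sum.cong) (fastforce simp: B_def)+
          also have "\<dots> = (\<Sum>(x,K)\<in>\<D>. measure lborel K *\<^sub>R (indicator N x::real))"
            using \<open>finite \<D>\<close> by (intro sum.mono_neutral_left) (auto simp: B_def indicator_def split: if_splits)
          also have "\<dots> < \<delta>" using g[THEN spec, THEN mp, OF conjI, OF D \<open>g fine \<D>\<close>] by simp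
          finally show "(\<Sum>(u, v)\<in>?p ` B. v - u) < \<delta>" .
        qed
        then show ?thesis
          by (subst (asm) sum.reindex[OF inj]) (auto simp: case_prod_unfold)
      qed
      have good: "(\<Sum>(x,K)\<in>\<D>-B. norm (measure lborel K *\<^sub>R h x - (f (Sup K) - f (Inf K)))) \<le> e / 4"
      proof -
        have "(\<Sum>(x,K)\<in>\<D>-B. norm (measure lborel K *\<^sub>R h x - (f (Sup K) - f (Inf K))))
            \<le> (\<Sum>(x,K)\<in>\<D>-B. e1 * (Sup K - Inf K))"
        proof (rule sum_mono, clarify)
          fix x K assume xK: "(x,K) \<in> \<D>" "(x,K) \<notin> B"
          then have "x \<notin> N" by (auto simp: B_def)
          obtain u v where uv: "K = {u..v}" "u \<le> v" "x \<in> {u..v}" "a \<le> u" "v \<le> b" "Inf K = u" "Sup K = v" "measure lborel K = v - u"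
            using K[OF xK(1)] by auto
          have "K \<subseteq> ball x (d x)" using \<open>(\<lambda>x. ball x (d x)) fine \<D>\<close> xK by (auto simp: fine_def)
          moreover have "u \<in> K" "v \<in> K" using uv by auto
          ultimately have "u \<in> ball x (d x)" "v \<in> ball x (d x)" by blast+
          then have *: "norm (f u - f x - (u-x) *\<^sub>R f' x) \<le> e1 * norm (u-x)"
               "norm (f v - f x - (v-x) *\<^sub>R f' x) \<le> e1 * norm (v-x)"
            using uv \<open>x \<notin> N\<close> d(2)[of x u] d(2)[of x v] by (auto simp: dist_norm)
          have "norm ((v - u) *\<^sub>R f' x - (f v - f u)) = norm ((f u - f x - (u-x) *\<^sub>R f' x) - (f v - f x - (v-x) *\<^sub>R f' x))"
            by (simp add: algebra_simps)
          also have "\<dots> \<le> e1 * norm (u-x) + e1 * norm (v-x)"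
            using * by (rule order.trans[OF norm_triangle_ineq4 add_mono])
          also have "\<dots> = e1 * (v - u)" using uv by (simp add: algebra_simps)
          finally show "norm (measure lborel K *\<^sub>R h x - (f (Sup K) - f (Inf K))) \<le> e1 * (Sup K - Inf K)"
            using uv \<open>x \<notin> N\<close> by (simp add: h_def)
        qed
        also have "\<dots> \<le> (\<Sum>(x,K)\<in>\<D>. e1 * (Sup K - Inf K))"
          using K \<open>finite \<D>\<close> \<open>e1 > 0\<close> by (intro sum_mono2) fastforce+
        also have "\<dots> = e1 * (\<Sum>(x,K)\<in>\<D>. Sup K - Inf K)"
          by (simp add: sum_distrib_left case_prod_unfold)
        also have "\<dots> = e1 * (b - a)"
          using additive_tagged_division_1[OF \<open>a \<le> b\<close> D, of "\<lambda>x. x"] by simp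
        finally show ?thesis using e1 by simp
      qed
      have "(\<Sum>(x,k)\<in>\<D>. measure lborel k *\<^sub>R h x) - (f b - f a) = (\<Sum>(x,K)\<in>\<D>. measure lborel K *\<^sub>R h x - (f (Sup K) - f (Inf K)))"
        using additive_tagged_division_1[OF \<open>a \<le> b\<close> D, of f] by (simp add: sum_subtractf case_prod_unfold)
      also have "norm \<dots> \<le> (\<Sum>(x,K)\<in>\<D>. norm (measure lborel K *\<^sub>R h x - (f (Sup K) - f (Inf K))))"
        by (simp add: sum_norm_le case_prod_unfold)
      also have "\<dots> = (\<Sum>(x,K)\<in>\<D>-B. norm (measure lborel K *\<^sub>R h x - (f (Sup K) - f (Inf K))))
           + (\<Sum>(x,K)\<in>B. norm (measure lborel K *\<^sub>R h x - (f (Sup K) - f (Inf K))))"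
        using sum.subset_diff[OF \<open>B \<subseteq> \<D>\<close> \<open>finite \<D>\<close>] .
      also have "(\<Sum>(x,K)\<in>B. norm (measure lborel K *\<^sub>R h x - (f (Sup K) - f (Inf K)))) = (\<Sum>(x,K)\<in>B. norm (f (Sup K) - f (Inf K)))"
        by (intro sum.cong) (auto simp: B_def h_def norm_minus_commute)
      finally show "norm ((\<Sum>(x,k)\<in>\<D>. measure lborel k *\<^sub>R h x) - (f b - f a)) < e"
        using good bad \<open>e > 0\<close> by simp
    qed
  qed
  then show ?thesis
    by (rule has_integral_spike[OF \<open>negligible N\<close>, rotated]) (auto simp: h_def)
qed

section \<open>Gronwall and energy inequalities\<close>

text \<open>
  Gronwall's inequality in a form without integrands: \<open>A\<close> plays the role of a primitive of the
  coefficient, and the hypothesis is what integrating the coefficient against an upper bound of \<open>w\<close>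
  would give. On an interval where \<open>A\<close> grows by \<open>a \<le> 1/2\<close>, taking \<open>M\<close> to be the maximum of \<open>w\<close>
  yields \<open>w u \<le> w v / (1 - a)\<close>, which is at most \<open>exp (2 * a) * w v\<close>; such bounds multiply when
  intervals are joined. The exponent is twice the optimal one.
\<close>
lemma gronwall_backward:
  fixes w A :: "real \<Rightarrow> real"
  assumes "u \<le> v" and w: "continuous_on {u..v} w" and A: "continuous_on {u..v} A" "mono_on {u..v} A"
    and nonneg: "\<And>r. r \<in> {u..v} \<Longrightarrow> 0 \<le> w r"
    and step: "\<And>p q M. u \<le> p \<Longrightarrow> p \<le> q \<Longrightarrow> q \<le> v \<Longrightarrow> (\<And>r. r \<in> {p..q} \<Longrightarrow> w r \<le> M) \<Longrightarrow>
                 w p \<le> w q + M * (A q - A p)"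
  shows "w u \<le> exp (2 * (A v - A u)) * w v"
proof -
  define P where "P p q \<longleftrightarrow> (u \<le> p \<and> p \<le> q \<and> q \<le> v \<longrightarrow> w p \<le> exp (2 * (A q - A p)) * w q)" for p q
  have "P u v" using \<open>u \<le> v\<close>
  proof (induction rule: Bolzano)
    case (trans p q r)
    show ?case unfolding P_def
    proof
      assume *: "u \<le> p \<and> p \<le> r \<and> r \<le> v"
      then have "w p \<le> exp (2 * (A q - A p)) * w q" using trans by (auto simp: P_def)
      also have "\<dots> \<le> exp (2 * (A q - A p)) * (exp (2 * (A r - A q)) * w r)"
        using trans * by (intro mult_left_mono) (auto simp: P_def)
      also have "\<dots> = exp (2 * (A r - A p)) * w r"
        by (simp add: mult.assoc[symmetric] exp_add[symmetric])
      finally show "w p \<le> exp (2 * (A r - A p)) * w r" .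
    qed
  next
    case (local x)
    then have "x \<in> {u..v}" by auto
    then obtain d where "d > 0" and d: "\<And>y. y \<in> {u..v} \<Longrightarrow> dist y x < d \<Longrightarrow> dist (A y) (A x) < 1/4"
      using A(1)[unfolded continuous_on_iff, rule_format, of x "1/4"] by auto
    show ?case unfolding P_def
    proof (intro exI[of _ d] conjI allI impI \<open>d > 0\<close>)
      fix p q assume px: "p \<le> x \<and> x \<le> q \<and> q - p < d" and uv: "u \<le> p \<and> p \<le> q \<and> q \<le> v"
      have "dist (A p) (A x) < 1/4" "dist (A q) (A x) < 1/4"
        using px uv by (intro d; simp add: dist_real_def)+
      then have small: "A q - A p \<le> 1/2" unfolding dist_real_def abs_less_iff by linarith
      define a where "a = A q - A p"
      have "0 \<le> a" "a \<le> 1/2" using mono_onD[OF A(2), of p q] uv small by (auto simp: a_def)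
      have "continuous_on {p..q} w" using w uv by (auto intro: continuous_on_subset)
      then obtain r where r: "r \<in> {p..q}" "\<And>y. y \<in> {p..q} \<Longrightarrow> w y \<le> w r"
        using continuous_attains_sup[of "{p..q}" w] uv by auto
      have "w r \<ge> 0" "w q \<ge> 0" using nonneg r(1) uv by auto
      have "w r \<le> w q + w r * (A q - A r)" using r uv by (intro step) auto
      also have "\<dots> \<le> w q + w r * a"
        using mono_onD[OF A(2), of p r] r uv \<open>w r \<ge> 0\<close> by (intro add_left_mono mult_left_mono) (auto simp: a_def)
      finally have 1: "w r * (1 - a) \<le> w q" by (simp add: algebra_simps)
      have "1 \<le> 1 + a * (1 - 2 * a)" using \<open>0 \<le> a\<close> \<open>a \<le> 1/2\<close> by simp
      also have "\<dots> = (1 - a) * (1 + 2 * a)" by (simp add: algebra_simps)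
      also have "\<dots> \<le> (1 - a) * exp (2 * a)"
        using \<open>a \<le> 1/2\<close> exp_ge_add_one_self[of "2*a"] by (intro mult_left_mono) auto
      finally have "w r * 1 \<le> w r * ((1 - a) * exp (2 * a))" using \<open>w r \<ge> 0\<close> by (rule mult_left_mono)
      also have "\<dots> = (w r * (1 - a)) * exp (2 * a)" by simp
      also have "\<dots> \<le> w q * exp (2 * a)" using 1 by (rule mult_right_mono) simp
      finally show "w p \<le> exp (2 * (A q - A p)) * w q"
        using r(2)[of p] uv by (simp add: a_def mult.commute)
    qed
  qed
  then show ?thesis using \<open>u \<le> v\<close> by (simp add: P_def)
qed

text \<open>The time reversal of \<open>gronwall_backward\<close>, with \<open>r\<close> replaced by \<open>- r\<close>.\<close>
lemma gronwall_forward: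
  fixes w A :: "real \<Rightarrow> real"
  assumes "u \<le> v" and w: "continuous_on {u..v} w" and A: "continuous_on {u..v} A" "mono_on {u..v} A"
    and nonneg: "\<And>r. r \<in> {u..v} \<Longrightarrow> 0 \<le> w r"
    and step: "\<And>p q M. u \<le> p \<Longrightarrow> p \<le> q \<Longrightarrow> q \<le> v \<Longrightarrow> (\<And>r. r \<in> {p..q} \<Longrightarrow> w r \<le> M) \<Longrightarrow>
                 w q \<le> w p + M * (A q - A p)"
  shows "w v \<le> exp (2 * (A v - A u)) * w u"
proof -
  have "w (- (- v)) \<le> exp (2 * (- A (- (- u)) - - A (- (- v)))) * w (- (- u))"
  proof (rule gronwall_backward[where w = "\<lambda>r. w (- r)" and A = "\<lambda>r. - A (- r)"])
    have *: "continuous_on {-v..-u} (uminus :: real \<Rightarrow> real)" "uminus ` {-v..-u} \<subseteq> {u..v}"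
      by (auto intro: continuous_on_minus continuous_on_id)
    show "continuous_on {-v..-u} (\<lambda>r. w (- r))" using w * by (rule continuous_on_compose2)
    show "continuous_on {-v..-u} (\<lambda>r. - A (- r))"
      using continuous_on_minus[OF continuous_on_compose2[OF A(1) *]] .
    show "mono_on {-v..-u} (\<lambda>r. - A (- r))" 
      using A(2) by (auto simp: mono_on_def)
    fix p q M assume "- v \<le> p" "p \<le> q" "q \<le> - u" and M: "\<And>r. r \<in> {p..q} \<Longrightarrow> w (- r) \<le> M"
    have "w (- p) \<le> w (- q) + M * (A (- p) - A (- q))"
    proof (rule step)
      fix r assume "r \<in> {-q..-p}"
      then show "w r \<le> M" using M[of "-r"] by auto
    qed (use \<open>- v \<le> p\<close> \<open>p \<le> q\<close> \<open>q \<le> - u\<close> in auto)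
    then show "w (- p) \<le> w (- q) + M * (- A (- q) - - A (- p))" by simp
  qed (use \<open>u \<le> v\<close> nonneg in auto)
  then show ?thesis by simp
qed

lemma has_integral_increments_continuous_on:
  fixes D h :: "real \<Rightarrow> 'a::banach"
  assumes "u \<le> v" and D: "\<And>p q. u \<le> p \<Longrightarrow> p \<le> q \<Longrightarrow> q \<le> v \<Longrightarrow> (h has_integral (D q - D p)) {p..q}"
  shows "continuous_on {u..v} D"
proof -
  have "h integrable_on {u..v}" using D[of u v] \<open>u \<le> v\<close> by auto
  then have "continuous_on {u..v} (\<lambda>r. D u + integral {u..r} h)"
    by (intro continuous_intros indefinite_integral_continuous_1)
  moreover have "D u + integral {u..r} h = D r" if "r \<in> {u..v}" for r
    using integral_unique[OF D[of u r]] that by auto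
  ultimately show ?thesis by (rule continuous_on_eq)
qed

text \<open>
  Formally \<open>h\<close> is the derivative of \<open>D\<close>, and the claim integrates the derivative \<open>2 * (D \<bullet> h)\<close> of
  \<open>(norm D)\<^sup>2\<close>. On a short interval the exact identity
  \<open>(norm (D q))\<^sup>2 - (norm (D p))\<^sup>2 = (D p + D q) \<bullet> (D q - D p)\<close> holds, the last factor is the integral
  of \<open>h\<close>, and \<open>D p + D q\<close> differs little from \<open>2 * D r\<close>. This proves the inequality with an extra
  error \<open>\<epsilon> * norm (h r)\<close> in the integrand, and \<open>\<epsilon>\<close> is arbitrary.
\<close>
lemma energy_inequality:
  fixes D h :: "real \<Rightarrow> 'a::euclidean_space"
  assumes "u \<le> v" and D: "\<And>p q. u \<le> p \<Longrightarrow> p \<le> q \<Longrightarrow> q \<le> v \<Longrightarrow> (h has_integral (D q - D p)) {p..q}"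
    and h: "h absolutely_integrable_on {u..v}" and k: "k integrable_on {u..v}"
    and le: "\<And>r. r \<in> {u..v} \<Longrightarrow> D r \<bullet> h r \<ge> - k r"
  shows "(norm (D u))\<^sup>2 \<le> (norm (D v))\<^sup>2 + 2 * integral {u..v} k"
proof -
  have contD: "continuous_on {u..v} D" using \<open>u \<le> v\<close> D by (rule has_integral_increments_continuous_on)
  have hn: "(\<lambda>r. norm (h r)) integrable_on {u..v}" using h by (simp add: absolutely_integrable_on_def)
  have main: "(norm (D u))\<^sup>2 \<le> (norm (D v))\<^sup>2 + 2 * integral {u..v} (\<lambda>r. k r + \<epsilon> * norm (h r))"
    if "\<epsilon> > 0" for \<epsilon>
  proof -
    let ?k = "\<lambda>r. k r + \<epsilon> * norm (h r)"
    have ki: "?k integrable_on {u..v}" by (intro integrable_add k integrable_on_mult_right hn)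
    define P where "P p q \<longleftrightarrow> (u \<le> p \<and> p \<le> q \<and> q \<le> v \<longrightarrow> (norm (D p))\<^sup>2 \<le> (norm (D q))\<^sup>2 + 2 * integral {p..q} ?k)" for p q
    have "P u v" using \<open>u \<le> v\<close>
    proof (induction rule: Bolzano)
      case (trans p q r)
      show ?case unfolding P_def
      proof
        assume *: "u \<le> p \<and> p \<le> r \<and> r \<le> v"
        have "integral {p..q} ?k + integral {q..r} ?k = integral {p..r} ?k"
          using trans * by (intro Henstock_Kurzweil_Integration.integral_combine integrable_on_subinterval[OF ki]) auto
        then show "(norm (D p))\<^sup>2 \<le> (norm (D r))\<^sup>2 + 2 * integral {p..r} ?k"
          using trans * by (auto simp: P_def)
      qed
    next
      case (local x)
      then have "x \<in> {u..v}" by auto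
      then obtain d where "d > 0" and d: "\<And>y. y \<in> {u..v} \<Longrightarrow> dist y x < d \<Longrightarrow> dist (D y) (D x) < \<epsilon>/2"
        using contD[unfolded continuous_on_iff, rule_format, of x "\<epsilon>/2"] \<open>\<epsilon> > 0\<close> by auto
      show ?case unfolding P_def
      proof (intro exI[of _ d] conjI allI impI \<open>d > 0\<close>)
        fix p q assume px: "p \<le> x \<and> x \<le> q \<and> q - p < d" and uv: "u \<le> p \<and> p \<le> q \<and> q \<le> v"
        have near: "norm (D y - D r) \<le> \<epsilon>" if "y \<in> {p..q}" "r \<in> {p..q}" for y r
        proof -
          have "dist (D y) (D x) < \<epsilon>/2" "dist (D r) (D x) < \<epsilon>/2"
            using px uv that by (intro d; auto simp: dist_real_def)+
          then show ?thesis using dist_triangle2[of "D y" "D r" "D x"] by (simp add: dist_norm)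
        qed
        let ?S = "D p + D q"
        have "((\<lambda>r. ?S \<bullet> h r) has_integral (?S \<bullet> (D q - D p))) {p..q}"
          using has_integral_linear[OF D bounded_linear_inner_right, of p q ?S] uv by (simp add: o_def)
        then have "((\<lambda>r. - (?S \<bullet> h r)) has_integral (- (?S \<bullet> (D q - D p)))) {p..q}" by (rule has_integral_neg)
        moreover have "((\<lambda>r. 2 * ?k r) has_integral (2 * integral {p..q} ?k)) {p..q}"
          using uv by (intro has_integral_mult_right integrable_integral integrable_on_subinterval[OF ki]) auto
        moreover have "- (?S \<bullet> h r) \<le> 2 * ?k r" if "r \<in> {p..q}" for r
        proof -
          have "norm (2 *\<^sub>R D r - ?S) = norm ((D r - D p) + (D r - D q))"
            by (simp add: scaleR_2 algebra_simps)
          also have "\<dots> \<le> \<epsilon> + \<epsilon>" using near[of r p] near[of r q] that uv by (intro order.trans[OF norm_triangle_ineq] add_mono) auto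
          finally have "norm (2 *\<^sub>R D r - ?S) * norm (h r) \<le> 2 * \<epsilon> * norm (h r)" by (intro mult_right_mono) auto
          then have "(2 *\<^sub>R D r - ?S) \<bullet> h r \<le> 2 * \<epsilon> * norm (h r)"
            using norm_cauchy_schwarz[of "2 *\<^sub>R D r - ?S" "h r"] by linarith
          then show ?thesis using le[of r] that uv by (simp add: inner_diff_left)
        qed
        ultimately have "- (?S \<bullet> (D q - D p)) \<le> 2 * integral {p..q} ?k" by (rule has_integral_le)
        moreover have "?S \<bullet> (D q - D p) = (norm (D q))\<^sup>2 - (norm (D p))\<^sup>2"
          by (simp add: power2_norm_eq_inner algebra_simps inner_commute)
        ultimately show "(norm (D p))\<^sup>2 \<le> (norm (D q))\<^sup>2 + 2 * integral {p..q} ?k" by simp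
      qed
    qed
    then show ?thesis using \<open>u \<le> v\<close> by (simp add: P_def)
  qed
  let ?c = "integral {u..v} (\<lambda>r. norm (h r))"
  have eq: "integral {u..v} (\<lambda>r. k r + \<epsilon> * norm (h r)) = integral {u..v} k + \<epsilon> * ?c" for \<epsilon>
    by (subst integral_add[OF k integrable_on_mult_right[OF hn]]) simp
  have "?c \<ge> 0" by (intro integral_nonneg hn) auto
  show ?thesis
  proof (rule field_le_epsilon)
    fix e :: real assume "e > 0"
    have "2 * (e / (2 * (?c + 1)) * ?c) \<le> e" using \<open>e > 0\<close> \<open>?c \<ge> 0\<close> by (simp add: field_simps)
    then show "(norm (D u))\<^sup>2 \<le> (norm (D v))\<^sup>2 + 2 * integral {u..v} k + e"
      using main[of "e / (2 * (?c + 1))"] \<open>e > 0\<close> \<open>?c \<ge> 0\<close> unfolding eq by (simp add: algebra_simps)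
  qed
qed

section \<open>Maps approximable by homeomorphisms\<close>

text \<open>Membership in the closure of the homeomorphisms of the space, for locally uniform convergence.\<close>
definition approximable_by_homeomorphisms :: "('a::euclidean_space \<Rightarrow> 'a) \<Rightarrow> bool" where
  "approximable_by_homeomorphisms f \<longleftrightarrow>
     (\<forall>R e. e > 0 \<longrightarrow> (\<exists>g g'. homeomorphism UNIV UNIV g g' \<and> (\<forall>x\<in>cball 0 R. dist (f x) (g x) < e)))"

lemma compact_avoids_value:
  fixes f :: "'a::t2_space \<Rightarrow> 'b::heine_borel"
  assumes "compact K" "continuous_on K f" "y \<notin> f ` K"
  obtains e where "e > 0" "\<And>x. x \<in> K \<Longrightarrow> e \<le> dist y (f x)"
proof -
  have "closed (f ` K)" using assms by (intro compact_imp_closed compact_continuous_image)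
  from separate_point_closed[OF this \<open>y \<notin> f ` K\<close>] show thesis using that by auto
qed

lemma connected_homeomorphism_preimage:
  assumes "homeomorphism UNIV UNIV g g'" "connected S"
  shows "connected (g -` S)"
proof -
  have "g -` S = g' ` S" using assms(1) by (auto simp: homeomorphism_def) (metis image_eqI)
  then show ?thesis
    using assms by (auto simp: homeomorphism_def intro: connected_continuous_image continuous_on_subset)
qed

text \<open>
  If the fiber were the union of two disjoint compact pieces, some bounded open \<open>U\<close> would contain
  one of them and have the other outside its closure. On the frontier of \<open>U\<close> the map stays away
  from \<open>y\<close>. For a homeomorphism \<open>g\<close> close to \<open>f\<close>, the preimage of a small ball around \<open>y\<close> is
  connected and meets both pieces, but misses the frontier of \<open>U\<close>.
\<close>
lemma connected_fiber_of_approximable: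
  fixes f :: "'a::euclidean_space \<Rightarrow> 'a"
  assumes f: "continuous_on UNIV f" and "approximable_by_homeomorphisms f" and bdd: "bounded (f -` {y})"
  shows "connected (f -` {y})"
proof (rule ccontr)
  have "closed (f -` {y})" using f by (simp add: continuous_closed_vimage continuous_on_eq_continuous_at)
  moreover assume "\<not> connected (f -` {y})"
  ultimately obtain A B where AB: "closed A" "closed B" "A \<noteq> {}" "B \<noteq> {}" "A \<union> B = f -` {y}" "A \<inter> B = {}"
    by (auto simp: connected_closed_set)
  have "compact A" "compact B"
    using AB bdd by (metis bounded_Un compact_eq_bounded_closed)+
  then obtain U V where U: "open U" "compact (closure U)" "A \<subseteq> U" "open V" "B \<subseteq> V" "U \<inter> V = {}"
    using separation_normal_compact[of A B] AB by metis
  have front: "frontier U \<inter> f -` {y} = {}"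
  proof -
    have "closure U \<inter> V = {}" using U by (simp add: open_Int_closure_eq_empty Int_commute)
    moreover have "f -` {y} \<subseteq> U \<union> V" using U AB(5) by blast
    ultimately show ?thesis using U(1) by (auto simp: frontier_def interior_open simp del: vimage_singleton_eq)
  qed
  have "compact (frontier U)" using U(2) by (simp add: frontier_def compact_diff)
  moreover have "y \<notin> f ` frontier U" using front by auto
  ultimately obtain e where "e > 0" and e: "\<And>x. x \<in> frontier U \<Longrightarrow> e \<le> dist y (f x)"
    using compact_avoids_value[OF _ continuous_on_subset[OF f subset_UNIV]] by metis
  have "bounded (closure U \<union> B)" using U(2) \<open>compact B\<close> by (simp add: compact_imp_bounded)
  then obtain R where R: "closure U \<union> B \<subseteq> cball 0 R"
    using bounded_subset_ballD[of _ 0] ball_subset_cball by (metis order_trans)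
  obtain g g' where g: "homeomorphism UNIV UNIV g g'" "\<And>x. x \<in> cball 0 R \<Longrightarrow> dist (f x) (g x) < e / 2"
    using assms(2)[unfolded approximable_by_homeomorphisms_def, THEN spec, THEN spec, THEN mp, OF half_gt_zero[OF \<open>e > 0\<close>], of R]
    by auto
  let ?S = "g -` ball y (e / 2)"
  have "connected ?S" using g(1) by (simp add: connected_homeomorphism_preimage)
  moreover obtain a b where ab: "a \<in> A" "b \<in> B" using AB by blast
  have "f a = y" "f b = y" "a \<in> cball 0 R" "b \<in> cball 0 R" "a \<in> U" "b \<notin> U"
    using ab AB(5) R U closure_subset[of U] by blast+
  then have "a \<in> ?S \<inter> U" "b \<in> ?S - U" using g(2)[of a] g(2)[of b] by auto
  ultimately have "?S \<inter> frontier U \<noteq> {}" using connected_Int_frontier by blast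
  then obtain z where z: "z \<in> frontier U" "dist y (g z) < e / 2" by auto
  then have "z \<in> cball 0 R" using R by (auto simp: frontier_def)
  then have "dist y (f z) < e" using g(2)[of z] z(2) by (metis dist_commute dist_triangle_half_l)
  with e[OF z(1)] show False by simp
qed

text \<open>
  Take a ball around \<open>y\<close> that contains \<open>f 0\<close>. Its preimage under a homeomorphism \<open>g\<close> close to \<open>f\<close>
  is connected and contains the origin. Properness of \<open>f\<close> prevents it from crossing a large sphere,
  so the point that \<open>g\<close> maps to \<open>y\<close> lies in a fixed compact set. There \<open>f\<close> gets within the
  approximation error of \<open>y\<close>, although \<open>y\<close> has positive distance from the image of that set.
\<close>
lemma surj_of_approximable:
  fixes f :: "'a::euclidean_space \<Rightarrow> 'a"
  assumes f: "continuous_on UNIV f" and "approximable_by_homeomorphisms f"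
    and bdd: "\<And>B. bounded B \<Longrightarrow> bounded (f -` B)"
  shows "surj f"
proof (rule ccontr)
  assume "\<not> surj f"
  then obtain y where y: "y \<notin> range f" by auto
  define r where "r = dist y (f 0) + 1"
  obtain R where "R > 0" and R: "f -` ball y (r + 1) \<subseteq> ball 0 R"
    using bounded_subset_ballD[OF bdd[OF bounded_ball]] by blast
  obtain e where "e > 0" and e: "\<And>x. x \<in> cball 0 R \<Longrightarrow> e \<le> dist y (f x)"
    using compact_avoids_value[OF compact_cball continuous_on_subset[OF f subset_UNIV], of y 0 R] y by blast
  obtain g g' where g: "homeomorphism UNIV UNIV g g'" "\<And>x. x \<in> cball 0 R \<Longrightarrow> dist (f x) (g x) < min e 1"
    using assms(2)[unfolded approximable_by_homeomorphisms_def, THEN spec[of _ R], THEN spec[of _ "min e 1"]] \<open>e > 0\<close>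
    by auto
  have gg': "g (g' x) = x" for x using g(1) by (auto simp: homeomorphism_def)
  let ?S = "g -` ball y r"
  have "connected ?S" using g(1) by (simp add: connected_homeomorphism_preimage)
  moreover have "0 \<in> ?S \<inter> cball 0 R"
    using g(2)[of 0] \<open>R > 0\<close> dist_triangle[of y "g 0" "f 0"] by (simp add: r_def)
  moreover have "?S \<inter> frontier (cball 0 R) = {}"
  proof -
    have "x \<in> ball 0 R" if "x \<in> ?S" "x \<in> cball 0 R" for x
    proof -
      have "dist y (f x) < r + 1"
        using that g(2)[of x] dist_triangle[of y "f x" "g x"] by (simp add: dist_commute)
      then show ?thesis using R by auto
    qed
    then show ?thesis by (fastforce simp: frontier_cball)
  qed
  ultimately have "?S \<subseteq> cball 0 R" using connected_Int_frontier[of ?S "cball 0 R"] by blast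
  moreover have "g' y \<in> ?S" by (simp add: gg' r_def add_nonneg_pos)
  ultimately have "g' y \<in> cball 0 R" by blast
  then have "dist (f (g' y)) y < e" "e \<le> dist y (f (g' y))" using g(2)[of "g' y"] e by (auto simp: gg')
  then show False by (simp add: dist_commute)
qed

text \<open>
  Two points of a connected fiber differ in some coordinate, and the fiber then meets a hyperplane
  on which that coordinate is a given rational number between the two values. Hence the points with
  several preimages are covered by countably many Lipschitz images of hyperplanes.
\<close>
lemma negligible_nonsingleton_fibers:
  fixes f :: "'a::euclidean_space \<Rightarrow> 'a"
  assumes lip: "\<And>x x'. norm (f x - f x') \<le> L * norm (x - x')"
    and conn: "\<And>y. connected (f -` {y})"
  shows "negligible {y. \<exists>x x'. x \<noteq> x' \<and> f x = y \<and> f x' = y}"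
proof -
  have "negligible (f ` {x. x \<bullet> k = q})" if "k \<in> Basis" for k :: 'a and q
  proof (rule negligible_locally_Lipschitz_image)
    show "negligible {x. x \<bullet> k = q}" using that by (rule negligible_standard_hyperplane)
    show "\<exists>T B. open T \<and> x \<in> T \<and> (\<forall>y\<in>{x. x \<bullet> k = q} \<inter> T. norm (f y - f x) \<le> B * norm (y - x))" for x
      using lip by (intro exI[of _ UNIV] exI[of _ L]) auto
  qed simp
  then have "negligible (\<Union>q\<in>\<rat>. f ` {x. x \<bullet> k = q})" if "k \<in> Basis" for k :: 'a
    using that countable_rat by (intro negligible_countable_Union) auto
  then have "negligible (\<Union>k\<in>Basis. \<Union>q\<in>\<rat>. f ` {x::'a. x \<bullet> k = q})"
    by (intro negligible_Union) auto
  moreover have "{y. \<exists>x x'. x \<noteq> x' \<and> f x = y \<and> f x' = y} \<subseteq> (\<Union>k\<in>Basis. \<Union>q\<in>\<rat>. f ` {x::'a. x \<bullet> k = q})"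
  proof (rule subsetI)
    have sep: "\<exists>k\<in>Basis. \<exists>q\<in>\<rat>. \<exists>z. z \<bullet> k = q \<and> f z = f x"
      if k: "k \<in> Basis" "x \<bullet> k < x' \<bullet> k" "f x = f x'" for k x x' :: 'a
    proof -
      obtain q where q: "q \<in> \<rat>" "x \<bullet> k < q" "q < x' \<bullet> k" using Rats_dense_in_real k(2) by blast
      obtain z where "z \<in> f -` {f x}" "k \<bullet> z = q"
        using connected_ivt_hyperplane[OF conn[of "f x"], of x x' k q] q k(3) by (auto simp: inner_commute)
      with q k(1) show ?thesis by (auto simp: inner_commute)
    qed
    fix y assume "y \<in> {y. \<exists>x x'. x \<noteq> x' \<and> f x = y \<and> f x' = y}"
    then obtain x x' where "x \<noteq> x'" and xx': "f x = y" "f x' = f x" by auto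
    then obtain k where "k \<in> Basis" "x \<bullet> k \<noteq> x' \<bullet> k" by (metis euclidean_eqI)
    then have "x \<bullet> k < x' \<bullet> k \<or> x' \<bullet> k < x \<bullet> k" by auto
    then obtain k q z where "k \<in> Basis" "q \<in> \<rat>" "z \<bullet> k = q" "f z = f x"
      using sep[of k x x'] sep[of k x' x] xx'(2) \<open>k \<in> Basis\<close> by auto
    then show "y \<in> (\<Union>k\<in>Basis. \<Union>q\<in>\<rat>. f ` {x::'a. x \<bullet> k = q})"
      using xx'(1) by (intro UN_I[of k] UN_I[of q] image_eqI[of _ _ z]) auto
  qed
  ultimately show ?thesis by (rule negligible_subset)
qed

text \<open>
  Over a neighbourhood of \<open>y\<close> the section takes values in a fixed compact set. The part of that set
  away from \<open>\<psi> y\<close> has a compact image that does not contain \<open>y\<close>, so values of the section over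
  points near \<open>y\<close> cannot lie in it.
\<close>
lemma isCont_section_at_singleton_fiber:
  fixes f :: "'a::euclidean_space \<Rightarrow> 'a"
  assumes f: "continuous_on UNIV f" and bdd: "\<And>B. bounded B \<Longrightarrow> bounded (f -` B)"
    and sec: "\<And>y. f (\<psi> y) = y" and single: "f -` {y} = {\<psi> y}"
  shows "isCont \<psi> y"
  unfolding continuous_at_eps_delta
proof (intro allI impI)
  fix e :: real assume "e > 0"
  obtain R where R: "f -` ball y 1 \<subseteq> cball 0 R"
    using bounded_subset_ballD[OF bdd[OF bounded_ball], of y 1 0] ball_subset_cball by (metis order_trans)
  let ?K = "cball 0 R - ball (\<psi> y) e"
  have "compact ?K" by (simp add: compact_diff)
  moreover have "y \<notin> f ` ?K"
  proof
    assume "y \<in> f ` ?K"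
    then obtain x where "x \<in> ?K" "f x = y" by blast
    then have "x \<in> f -` {y}" by simp
    then show False using single \<open>x \<in> ?K\<close> \<open>e > 0\<close> by simp
  qed
  ultimately obtain d where "d > 0" and d: "\<And>x. x \<in> ?K \<Longrightarrow> d \<le> dist y (f x)"
    using compact_avoids_value[OF _ continuous_on_subset[OF f subset_UNIV]] by metis
  show "\<exists>d>0. \<forall>y'. dist y' y < d \<longrightarrow> dist (\<psi> y') (\<psi> y) < e"
  proof (intro exI[of _ "min d 1"] conjI allI impI)
    fix y' assume "dist y' y < min d 1"
    then have "\<psi> y' \<in> f -` ball y 1" "\<psi> y' \<notin> ?K"
      using d[of "\<psi> y'"] sec[of y'] by (auto simp: dist_commute)
    moreover from this(1) have "\<psi> y' \<in> cball 0 R" using R by blast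
    ultimately show "dist (\<psi> y') (\<psi> y) < e" by (auto simp: dist_commute)
  qed (use \<open>d > 0\<close> in auto)
qed

text \<open>
  A single approximation property, in which \<open>x\<close> and \<open>x'\<close> may differ, supplies everything about
  \<open>f\<close>: comparing \<open>f x\<close> and \<open>f x'\<close> with the same value \<open>g x'\<close> and letting \<open>e\<close> tend to zero gives the
  Lipschitz bound, and the case \<open>x = x'\<close> gives approximability by homeomorphisms.
\<close>
lemma ae_continuous_inverse:
  fixes f :: "'a::euclidean_space \<Rightarrow> 'a"
  assumes approx: "\<And>R e. 0 \<le> R \<Longrightarrow> 0 < e \<Longrightarrow> \<exists>g g'. homeomorphism UNIV UNIV g g' \<and>
      (\<forall>x\<in>cball 0 R. \<forall>x'\<in>cball 0 R. norm (f x - g x') \<le> L * norm (x - x') + e)"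
    and coercive: "\<And>x. norm x \<le> K * (1 + norm (f x))"
  obtains A \<psi> where "negligible (- A)" "\<And>y. y \<in> A \<Longrightarrow> f -` {y} = {\<psi> y}" "\<And>y. y \<in> A \<Longrightarrow> isCont \<psi> y"
proof -
  have lip: "norm (f x - f x') \<le> L * norm (x - x')" for x x'
  proof (rule field_le_epsilon)
    fix e :: real assume "e > 0"
    define R where "R = norm x + norm x'"
    have "0 \<le> R" "0 < e / 2" using \<open>e > 0\<close> by (auto simp: R_def)
    from approx[OF this] obtain g where
      g: "\<And>x x'. x \<in> cball 0 R \<Longrightarrow> x' \<in> cball 0 R \<Longrightarrow> norm (f x - g x') \<le> L * norm (x - x') + e / 2" by blast
    have "norm (f x - g x') \<le> L * norm (x - x') + e / 2" "norm (f x' - g x') \<le> L * norm (x' - x') + e / 2"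
      by (rule g; simp add: R_def)+
    then show "norm (f x - f x') \<le> L * norm (x - x') + e"
      using norm_triangle_ineq4[of "f x - g x'" "f x' - g x'"] by simp
  qed
  have cont: "continuous_on UNIV f"
  proof (rule lipschitz_on_continuous_on[of "max 0 L"], rule lipschitz_onI)
    fix x y :: 'a
    have "L * dist x y \<le> max 0 L * dist x y" by (intro mult_right_mono) auto
    then show "dist (f x) (f y) \<le> max 0 L * dist x y" using lip[of x y] by (simp add: dist_norm)
  qed simp
  have approx': "approximable_by_homeomorphisms f"
    unfolding approximable_by_homeomorphisms_def
  proof (intro allI impI)
    fix R e :: real assume "e > 0"
    then obtain g g' where g: "homeomorphism UNIV UNIV g g'"
      "\<And>x. x \<in> cball 0 (max 0 R) \<Longrightarrow> norm (f x - g x) \<le> e / 2"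
      using approx[of "max 0 R" "e / 2"] by fastforce
    have "dist (f x) (g x) < e" if "x \<in> cball 0 R" for x
    proof -
      have "norm (f x - g x) \<le> e / 2" using that by (intro g(2)) auto
      then show ?thesis using \<open>e > 0\<close> by (simp add: dist_norm)
    qed
    with g(1) show "\<exists>g g'. homeomorphism UNIV UNIV g g' \<and> (\<forall>x\<in>cball 0 R. dist (f x) (g x) < e)"
      by blast
  qed
  have bdd: "bounded (f -` B)" if B: "bounded B" for B
  proof -
    obtain r where r: "\<And>y. y \<in> B \<Longrightarrow> norm y \<le> r" using B by (auto simp: bounded_iff)
    have "norm x \<le> max 0 K * (1 + r)" if "f x \<in> B" for x
    proof -
      have "norm x \<le> K * (1 + norm (f x))" by (rule coercive)
      also have "\<dots> \<le> max 0 K * (1 + norm (f x))" by (intro mult_right_mono) auto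
      also have "\<dots> \<le> max 0 K * (1 + r)" using r[OF that] by (intro mult_left_mono) auto
      finally show ?thesis .
    qed
    then show ?thesis by (auto simp: bounded_iff)
  qed
  have conn: "connected (f -` {y})" for y
    using cont approx' bdd by (rule connected_fiber_of_approximable) simp
  have surj: "surj f" using cont approx' bdd by (rule surj_of_approximable)
  define \<psi> where "\<psi> = inv f"
  have sec: "f (\<psi> y) = y" for y using surj by (simp add: \<psi>_def surj_f_inv_f)
  define G where "G = {y. f -` {y} = {\<psi> y}}"
  have G: "f -` {y} = {\<psi> y}" if "y \<in> G" for y using that unfolding G_def by (rule CollectD)
  have "- G \<subseteq> {y. \<exists>x x'. x \<noteq> x' \<and> f x = y \<and> f x' = y}"
  proof
    fix y assume "y \<in> - G"
    moreover have "\<psi> y \<in> f -` {y}" using sec by simp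
    ultimately obtain x where "x \<in> f -` {y}" "x \<noteq> \<psi> y" unfolding G_def by blast
    then show "y \<in> {y. \<exists>x x'. x \<noteq> x' \<and> f x = y \<and> f x' = y}" using sec[of y] by auto
  qed
  with negligible_nonsingleton_fibers[OF lip conn] have "negligible (- G)" by (rule negligible_subset)
  moreover have "isCont \<psi> y" if "y \<in> G" for y
    by (rule isCont_section_at_singleton_fiber[OF cont bdd sec G[OF that]])
  ultimately show thesis using that[of G \<psi>] G by blast
qed

section \<open>Lipschitz weights and perturbations of the identity\<close>

text \<open>
  A partition of unity on a ball, subordinate to balls of radius \<open>e\<close> with centres in the dense set
  \<open>X\<close>, whose members are Lipschitz on the whole space: normalise tent functions by their sum.
  Truncating the sum from below by \<open>e / 2\<close>, a value that it exceeds on the given ball, keeps the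
  quotients Lipschitz elsewhere, at the price of total weight below one there.
\<close>
lemma lipschitz_bumps:
  fixes X :: "'a::euclidean_space set"
  assumes "e > 0" and dense: "\<And>x d. d > 0 \<Longrightarrow> \<exists>z\<in>X. dist z x < d"
  obtains Z L and w :: "'a \<Rightarrow> 'a \<Rightarrow> real" where "finite Z" "Z \<subseteq> X" "0 \<le> L"
    "\<And>z x. 0 \<le> w z x" "\<And>z x. 0 < w z x \<Longrightarrow> dist x z < e"
    "\<And>x. (\<Sum>z\<in>Z. w z x) \<le> 1" "\<And>x. x \<in> cball 0 R \<Longrightarrow> (\<Sum>z\<in>Z. w z x) = 1"
    "\<And>z x x'. z \<in> Z \<Longrightarrow> \<bar>w z x - w z x'\<bar> \<le> L * dist x x'"
proof -
  have "cball 0 R \<subseteq> (\<Union>z\<in>X. ball z (e / 2))"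
    using dense[of "e / 2"] \<open>e > 0\<close> by (auto simp: subset_iff)
  then obtain Z where Z: "Z \<subseteq> X" "finite Z" "cball 0 R \<subseteq> (\<Union>z\<in>Z. ball z (e / 2))"
    using compactE_image[OF compact_cball[of "0::'a" R], of X "\<lambda>z. ball z (e / 2)"] by auto
  define \<tau> where "\<tau> z x = max 0 (e - dist x z)" for z x :: 'a
  define S where "S x = (\<Sum>z\<in>Z. \<tau> z x)" for x
  define q where "q x = max (e / 2) (S x)" for x
  define w where "w z x = \<tau> z x / q x" for z x
  define L where "L = (1 + real (card Z)) / (e / 2)"
  have \<tau>0: "0 \<le> \<tau> z x" for z x by (simp add: \<tau>_def)
  have q0: "e / 2 \<le> q x" "0 < q x" "S x \<le> q x" for x using \<open>e > 0\<close> by (auto simp: q_def)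
  have \<tau>L: "\<bar>\<tau> z x - \<tau> z x'\<bar> \<le> dist x x'" for z x x'
    using dist_triangle[of x z x'] dist_triangle[of x' z x] by (auto simp: \<tau>_def dist_commute)
  have SL: "\<bar>S x - S x'\<bar> \<le> real (card Z) * dist x x'" for x x'
  proof -
    have "\<bar>S x - S x'\<bar> \<le> (\<Sum>z\<in>Z. \<bar>\<tau> z x - \<tau> z x'\<bar>)"
      unfolding S_def sum_subtractf[symmetric] by (rule sum_abs)
    also have "\<dots> \<le> (\<Sum>z\<in>Z. dist x x')" by (intro sum_mono \<tau>L)
    finally show ?thesis by simp
  qed
  have qL: "\<bar>q x - q x'\<bar> \<le> real (card Z) * dist x x'" for x x'
    using SL[of x x'] by (auto simp: q_def)
  have \<tau>S: "\<tau> z x \<le> q x" if "z \<in> Z" for z x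
    using member_le_sum[of z Z "\<lambda>z. \<tau> z x"] that \<tau>0 Z(2) q0(3)[of x] unfolding S_def by fastforce
  show thesis
  proof (rule that[of Z L w])
    show "finite Z" "Z \<subseteq> X" by (fact Z)+
    show "0 \<le> L" using \<open>e > 0\<close> by (simp add: L_def)
    show "0 \<le> w z x" for z x using \<tau>0[of z x] q0(2)[of x] by (simp add: w_def)
    show "dist x z < e" if "0 < w z x" for z x
      using that q0(2)[of x] by (auto simp: w_def \<tau>_def zero_less_divide_iff max_def split: if_splits)
    have sumw: "(\<Sum>z\<in>Z. w z x) = S x / q x" for x by (simp add: w_def S_def sum_divide_distrib)
    show "(\<Sum>z\<in>Z. w z x) \<le> 1" for x using q0(2,3)[of x] by (simp add: sumw)
    show "(\<Sum>z\<in>Z. w z x) = 1" if x: "x \<in> cball 0 R" for x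
    proof -
      obtain z where z: "z \<in> Z" "x \<in> ball z (e / 2)" using x Z(3) by auto
      then have "e / 2 \<le> \<tau> z x" by (auto simp: \<tau>_def dist_commute le_max_iff_disj)
      also have "\<dots> \<le> S x" unfolding S_def using z(1) Z(2) \<tau>0 by (intro member_le_sum) auto
      finally have "q x = S x" by (simp add: q_def)
      then show ?thesis using q0(2)[of x] by (simp add: sumw)
    qed
    fix z x x' :: 'a assume z: "z \<in> Z"
    let ?d = "dist x x'"
    have "w z x - w z x' = (\<tau> z x - \<tau> z x') / q x + (\<tau> z x' / q x') * ((q x' - q x) / q x)"
      using q0(2)[of x] q0(2)[of x'] by (simp add: w_def field_simps)
    also have "\<bar>\<dots>\<bar> \<le> \<bar>(\<tau> z x - \<tau> z x') / q x\<bar> + \<bar>\<tau> z x' / q x'\<bar> * \<bar>(q x' - q x) / q x\<bar>"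
      by (metis abs_mult abs_triangle_ineq)
    also have "\<dots> \<le> ?d / (e / 2) + 1 * (real (card Z) * ?d / (e / 2))"
    proof (intro add_mono mult_mono)
      show "\<bar>(\<tau> z x - \<tau> z x') / q x\<bar> \<le> ?d / (e / 2)"
        unfolding abs_divide using \<tau>L[of z x x'] q0[of x] \<open>e > 0\<close> by (intro frac_le) auto
      show "\<bar>(q x' - q x) / q x\<bar> \<le> real (card Z) * ?d / (e / 2)"
        unfolding abs_divide using qL[of x' x] q0[of x] \<open>e > 0\<close> by (intro frac_le) (auto simp: dist_commute)
      show "\<bar>\<tau> z x' / q x'\<bar> \<le> 1" using \<tau>S[OF z, of x'] \<tau>0[of z x'] q0(2)[of x'] by simp
    qed auto
    also have "\<dots> = L * ?d" by (simp add: L_def add_divide_distrib ring_distribs mult_ac)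
    finally show "\<bar>w z x - w z x'\<bar> \<le> L * dist x x'" .
  qed
qed

text \<open>
  By the Banach fixed point theorem \<open>x = y + k x\<close> has exactly one solution for each \<open>y\<close>, and it
  depends on \<open>y\<close> with Lipschitz constant \<open>2\<close>.
\<close>
lemma homeomorphism_minus_contraction:
  fixes k :: "'a::euclidean_space \<Rightarrow> 'a"
  assumes k: "\<And>x y. dist (k x) (k y) \<le> 1/2 * dist x y"
  obtains g' where "homeomorphism UNIV UNIV (\<lambda>x. x - k x) g'"
proof -
  have eq: "x - k x = y \<longleftrightarrow> y + k x = x" for x y by (auto simp: diff_eq_eq)
  have ex1: "\<exists>!x. x - k x = y" for y
    unfolding eq
    using banach_fix_type[of "1/2" "\<lambda>x. y + k x"] k by simp
  define g' where "g' y = (THE x. x - k x = y)" for y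
  have g': "g' y - k (g' y) = y" for y unfolding g'_def using ex1 by (rule theI')
  have inv: "g' (x - k x) = x" for x using g' ex1 by blast
  have lip: "dist (g' x) (g' y) \<le> 2 * dist x y" for x y
  proof -
    have "dist (g' x) (g' y) = norm ((x - y) + (k (g' x) - k (g' y)))"
      using g'[of x] g'[of y] by (metis (no_types, opaque_lifting) add_diff_add diff_add_cancel dist_norm)
    also have "\<dots> \<le> dist x y + dist (k (g' x)) (k (g' y))" by (simp add: dist_norm norm_triangle_ineq)
    finally show ?thesis using k[of "g' x" "g' y"] by simp
  qed
  have "continuous_on UNIV g'"
    by (rule lipschitz_on_continuous_on[of 2]) (use lip in \<open>auto simp: lipschitz_on_def\<close>)
  moreover have "continuous_on UNIV k"
    by (rule lipschitz_on_continuous_on[of "1/2"]) (use k in \<open>auto simp: lipschitz_on_def\<close>)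
  then have "continuous_on UNIV (\<lambda>x. x - k x)" by (intro continuous_on_diff continuous_on_id)
  ultimately have "homeomorphism UNIV UNIV (\<lambda>x. x - k x) g'"
    using g' inv by (auto simp: homeomorphism_def) (metis UNIV_I image_eqI)+
  then show thesis by (rule that)
qed

section \<open>Integral curves of a one-sided Lipschitz field\<close>

text \<open>
  One function \<open>C\<close> bounds both the growth and the one-sided Lipschitz constant of the field; the sum
  of separate bounds can be taken. All estimates are then in terms of increments of its primitive.
\<close>
locale one_sided_field =
  fixes T :: real and b :: "real \<Rightarrow> 'a::euclidean_space \<Rightarrow> 'a" and C :: "real \<Rightarrow> real"
  assumes C_integrable: "C integrable_on {0..T}"
    and C_nonneg: "\<And>t. t \<in> {0..T} \<Longrightarrow> 0 \<le> C t"
    and growth: "\<And>t x. t \<in> {0..T} \<Longrightarrow> norm (b t x) \<le> C t * (1 + norm x)"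
    and one_sided: "\<And>t x y. t \<in> {0..T} \<Longrightarrow> - C t * (norm (x - y))\<^sup>2 \<le> (b t x - b t y) \<bullet> (x - y)"
    and sections: "AE z in lborel. (\<lambda>t. b t z) \<in> borel_measurable (lebesgue_on {0..T})"
begin

definition cumC :: "real \<Rightarrow> real" where "cumC r = integral {0..r} C"

lemma cumC_diff:
  assumes "0 \<le> p" "p \<le> q" "q \<le> T"
  shows "C integrable_on {p..q}" "integral {p..q} C = cumC q - cumC p"
proof -
  show "C integrable_on {p..q}" using C_integrable by (rule integrable_on_subinterval) (use assms in auto)
  have "C integrable_on {0..q}" using C_integrable by (rule integrable_on_subinterval) (use assms in auto)
  from Henstock_Kurzweil_Integration.integral_combine[OF assms(1,2) this]
  show "integral {p..q} C = cumC q - cumC p" by (simp add: cumC_def)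
qed

lemma cumC_continuous: "continuous_on {0..T} cumC"
  unfolding cumC_def using C_integrable by (rule indefinite_integral_continuous_1)

lemma cumC_mono: "0 \<le> p \<Longrightarrow> p \<le> q \<Longrightarrow> q \<le> T \<Longrightarrow> cumC p \<le> cumC q"
  using cumC_diff[of p q] integral_nonneg[of C "{p..q}"] C_nonneg by auto

text \<open>
  Velocities at \<open>(t, x)\<close> that satisfy the growth bound and the one-sided condition against all
  values of the field. This set contains the Filippov hull and also the value \<open>b t x\<close>, so a Filippov
  solution has an admissible velocity at every time once the value of the field is used at the
  times of a null set.
\<close>
definition admissible :: "real \<Rightarrow> 'a \<Rightarrow> 'a set" where
  "admissible t x = {v. norm v \<le> C t * (1 + norm x) \<and>
     (\<forall>z. - C t * (norm (x - z))\<^sup>2 \<le> (v - b t z) \<bullet> (x - z))}"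

lemma b_admissible: "t \<in> {0..T} \<Longrightarrow> b t x \<in> admissible t x"
  using growth one_sided by (simp add: admissible_def)

text \<open>
  Both conditions that define admissibility are convex in the velocity and survive the passage to
  limits \<open>b t (y n) \<longlonglongrightarrow> v\<close> along \<open>y n \<longlonglongrightarrow> x\<close>.
\<close>
lemma filippov_hull_admissible:
  assumes t: "t \<in> {0..T}"
  shows "filippov_hull b t x \<subseteq> admissible t x"
  unfolding filippov_hull_def
proof (rule hull_minimal)
  show "convex (admissible t x)"
  proof -
    have "admissible t x = cball 0 (C t * (1 + norm x)) \<inter>
        (\<Inter>z. {v. - C t * (norm (x - z))\<^sup>2 + (x - z) \<bullet> b t z \<le> (x - z) \<bullet> v})"
      by (auto simp: admissible_def inner_diff_left inner_diff_right inner_commute algebra_simps)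
    then show ?thesis by (auto intro!: convex_Int convex_INT convex_halfspace_ge)
  qed
  show "limit_points_at (b t) x \<subseteq> admissible t x"
  proof
    fix v assume "v \<in> limit_points_at (b t) x"
    then obtain y where y: "filterlim y (at x) sequentially" and v: "(\<lambda>n. b t (y n)) \<longlonglongrightarrow> v"
      by (auto simp: limit_points_at_def)
    from y have y: "y \<longlonglongrightarrow> x" by (simp add: filterlim_at)
    have "norm v \<le> C t * (1 + norm x)"
      by (rule LIMSEQ_le[where X = "\<lambda>n. norm (b t (y n))" and Y = "\<lambda>n. C t * (1 + norm (y n))"])
        (use growth[OF t] y v in \<open>auto intro!: tendsto_intros\<close>)
    moreover have "- C t * (norm (x - z))\<^sup>2 \<le> (v - b t z) \<bullet> (x - z)" for z
      by (rule LIMSEQ_le[where X = "\<lambda>n. - C t * (norm (y n - z))\<^sup>2" and Y = "\<lambda>n. (b t (y n) - b t z) \<bullet> (y n - z)"])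
        (use one_sided[OF t] y v in \<open>auto intro!: tendsto_intros\<close>)
    ultimately show "v \<in> admissible t x" by (simp add: admissible_def)
  qed
qed

definition integral_curve :: "real \<Rightarrow> real \<Rightarrow> (real \<Rightarrow> 'a) \<Rightarrow> bool" where
  "integral_curve u v \<gamma> \<longleftrightarrow> (\<exists>\<gamma>'. (\<forall>p q. u \<le> p \<longrightarrow> p \<le> q \<longrightarrow> q \<le> v \<longrightarrow> (\<gamma>' has_integral (\<gamma> q - \<gamma> p)) {p..q}) \<and>
     (\<forall>r\<in>{u..v}. \<gamma>' r \<in> admissible r (\<gamma> r)))"

lemma integral_curve_subinterval:
  "integral_curve u v \<gamma> \<Longrightarrow> u \<le> p \<Longrightarrow> q \<le> v \<Longrightarrow> integral_curve p q \<gamma>"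
  unfolding integral_curve_def by (elim exE, rule exI) auto

lemma integral_curve_filippov_solution:
  assumes s: "s \<in> {0..T}" and sol: "backward_filippov_solution b s x \<gamma>"
  shows "integral_curve 0 s \<gamma>"
proof -
  let ?Q = "\<lambda>t v. v \<in> filippov_hull b t (\<gamma> t) \<and> (\<gamma> has_vector_derivative v) (at t within {0..s})"
  define \<gamma>' where "\<gamma>' t = (if Ex (?Q t) then Eps (?Q t) else b t (\<gamma> t))" for t
  have Q: "?Q t (\<gamma>' t)" if "Ex (?Q t)" for t
  proof -
    have "?Q t (Eps (?Q t))" using that by (rule someI_ex)
    then show ?thesis using that by (simp add: \<gamma>'_def)
  qed
  have ac: "abs_continuous_on 0 s \<gamma>" and ae: "AE t in lebesgue_on {0..s}. Ex (?Q t)"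
    using sol by (auto simp: backward_filippov_solution_def Bex_def)
  from ae have "AE t in lebesgue. t \<in> {0..s} \<longrightarrow> Ex (?Q t)" by (subst (asm) AE_restrict_space_iff) auto
  then obtain N where N: "N \<in> null_sets lebesgue" "{t. \<not> (t \<in> {0..s} \<longrightarrow> Ex (?Q t))} \<subseteq> N"
    by (auto simp: eventually_ae_filter)
  have neg: "negligible N" using N(1) by (simp add: negligible_iff_null_sets)
  have "(\<gamma>' has_integral (\<gamma> q - \<gamma> p)) {p..q}" if "0 \<le> p" "p \<le> q" "q \<le> s" for p q
  proof (rule abs_continuous_on_FTC[OF \<open>p \<le> q\<close> _ neg])
    show "abs_continuous_on p q \<gamma>"
      unfolding abs_continuous_on_def
    proof (intro allI impI)
      fix e :: real assume "e > 0"
      from ac[unfolded abs_continuous_on_def, THEN spec, THEN mp, OF this] obtain d where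
        "d > 0" and d: "\<forall>D. finite D \<longrightarrow> (\<forall>(u, v)\<in>D. 0 \<le> u \<and> u \<le> v \<and> v \<le> s) \<longrightarrow>
        pairwise (\<lambda>(u, v) (u', v'). {u<..<v} \<inter> {u'<..<v'} = {}) D \<longrightarrow>
        (\<Sum>(u, v)\<in>D. v - u) < d \<longrightarrow> (\<Sum>(u, v)\<in>D. norm (\<gamma> v - \<gamma> u)) < e" by (elim exE conjE)
      show "\<exists>d>0. \<forall>D. finite D \<longrightarrow> (\<forall>(u, v)\<in>D. p \<le> u \<and> u \<le> v \<and> v \<le> q) \<longrightarrow>
        pairwise (\<lambda>(u, v) (u', v'). {u<..<v} \<inter> {u'<..<v'} = {}) D \<longrightarrow>
        (\<Sum>(u, v)\<in>D. v - u) < d \<longrightarrow> (\<Sum>(u, v)\<in>D. norm (\<gamma> v - \<gamma> u)) < e"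
      proof (intro exI[of _ d] conjI allI impI \<open>d > 0\<close>)
        fix D :: "(real \<times> real) set"
        assume D: "finite D" "\<forall>(u, v)\<in>D. p \<le> u \<and> u \<le> v \<and> v \<le> q"
          "pairwise (\<lambda>(u, v) (u', v'). {u<..<v} \<inter> {u'<..<v'} = {}) D" "(\<Sum>(u, v)\<in>D. v - u) < d"
        have "\<forall>(u, v)\<in>D. 0 \<le> u \<and> u \<le> v \<and> v \<le> s" using D(2) that by fastforce
        from d[THEN spec, THEN mp, THEN mp, THEN mp, THEN mp, OF D(1) this D(3,4)]
        show "(\<Sum>(u, v)\<in>D. norm (\<gamma> v - \<gamma> u)) < e" .
      qed
    qed
    fix t assume t: "t \<in> {p..q} - N"
    then have "t \<in> {0..s}" "t \<notin> {t. \<not> (t \<in> {0..s} \<longrightarrow> Ex (?Q t))}" using N(2) that by (force, blast)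
    then have "?Q t (\<gamma>' t)" by (intro Q) blast
    then show "(\<gamma> has_vector_derivative \<gamma>' t) (at t within {p..q})"
      using that by (auto intro: has_vector_derivative_within_subset)
  qed
  moreover have "\<gamma>' r \<in> admissible r (\<gamma> r)" if "r \<in> {0..s}" for r
  proof -
    have r: "r \<in> {0..T}" using that s by auto
    show ?thesis
      using Q[of r] filippov_hull_admissible[OF r, of "\<gamma> r"] b_admissible[OF r, of "\<gamma> r"] by (cases "Ex (?Q r)") (auto simp: \<gamma>'_def)
  qed
  ultimately show ?thesis unfolding integral_curve_def by blast
qed

lemma integral_curve_continuous:
  assumes "integral_curve u v \<gamma>" "u \<le> v"
  shows "continuous_on {u..v} \<gamma>"
  using assms has_integral_increments_continuous_on[of u v] unfolding integral_curve_def by metis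

lemma integral_curve_increment:
  assumes \<gamma>: "integral_curve u v \<gamma>" and uv: "0 \<le> u" "v \<le> T" and pq: "u \<le> p" "p \<le> q" "q \<le> v"
    and M: "\<And>r. r \<in> {p..q} \<Longrightarrow> 1 + norm (\<gamma> r) \<le> M"
  shows "norm (\<gamma> q - \<gamma> p) \<le> M * (cumC q - cumC p)"
proof -
  obtain \<gamma>' where \<gamma>': "(\<gamma>' has_integral (\<gamma> q - \<gamma> p)) {p..q}" "\<And>r. r \<in> {u..v} \<Longrightarrow> \<gamma>' r \<in> admissible r (\<gamma> r)"
    using \<gamma> pq unfolding integral_curve_def by metis
  have "norm (integral {p..q} \<gamma>') \<le> integral {p..q} (\<lambda>r. C r * M)"
  proof (rule integral_norm_bound_integral)
    show "\<gamma>' integrable_on {p..q}" using \<gamma>'(1) by auto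
    show "(\<lambda>r. C r * M) integrable_on {p..q}" using cumC_diff(1)[of p q] uv pq by (intro integrable_on_mult_left) auto
    fix r assume r: "r \<in> {p..q}"
    then have "norm (\<gamma>' r) \<le> C r * (1 + norm (\<gamma> r))" using \<gamma>'(2)[of r] pq by (auto simp: admissible_def)
    also have "\<dots> \<le> C r * M" using M[OF r] C_nonneg[of r] r uv pq by (intro mult_left_mono) auto
    finally show "norm (\<gamma>' r) \<le> C r * M" .
  qed
  then show ?thesis using integral_unique[OF \<gamma>'(1)] cumC_diff(2)[of p q] uv pq by (simp add: mult.commute)
qed

text \<open>
  The bound forward in time says that the flow map is proper; the one backward in time confines the
  curves that end in a ball.
\<close>
lemma integral_curve_growth:
  assumes \<gamma>: "integral_curve u v \<gamma>" and uv: "0 \<le> u" "u \<le> v" "v \<le> T"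
  shows "1 + norm (\<gamma> u) \<le> exp (2 * (cumC v - cumC u)) * (1 + norm (\<gamma> v))"
    and "1 + norm (\<gamma> v) \<le> exp (2 * (cumC v - cumC u)) * (1 + norm (\<gamma> u))"
proof -
  have cont: "continuous_on {u..v} (\<lambda>r. 1 + norm (\<gamma> r))"
    using integral_curve_continuous[OF \<gamma> uv(2)] by (intro continuous_intros)
  have cont_cumC: "continuous_on {u..v} cumC" using cumC_continuous uv by (auto intro: continuous_on_subset)
  have mono_cumC: "mono_on {u..v} cumC" using cumC_mono uv by (auto intro!: mono_onI)
  note incr = integral_curve_increment[OF \<gamma> uv(1,3)]
  show "1 + norm (\<gamma> u) \<le> exp (2 * (cumC v - cumC u)) * (1 + norm (\<gamma> v))"
  proof (rule gronwall_backward[OF uv(2) cont cont_cumC mono_cumC])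
    fix p q M assume "u \<le> p" "p \<le> q" "q \<le> v" "\<And>r. r \<in> {p..q} \<Longrightarrow> 1 + norm (\<gamma> r) \<le> M"
    from incr[OF this] show "1 + norm (\<gamma> p) \<le> 1 + norm (\<gamma> q) + M * (cumC q - cumC p)"
      using norm_triangle_ineq3[of "\<gamma> q" "\<gamma> p"] by simp
  qed auto
  show "1 + norm (\<gamma> v) \<le> exp (2 * (cumC v - cumC u)) * (1 + norm (\<gamma> u))"
  proof (rule gronwall_forward[OF uv(2) cont cont_cumC mono_cumC])
    fix p q M assume "u \<le> p" "p \<le> q" "q \<le> v" "\<And>r. r \<in> {p..q} \<Longrightarrow> 1 + norm (\<gamma> r) \<le> M"
    from incr[OF this] show "1 + norm (\<gamma> q) \<le> 1 + norm (\<gamma> p) + M * (cumC q - cumC p)"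
      using norm_triangle_ineq3[of "\<gamma> q" "\<gamma> p"] by simp
  qed auto
qed

section \<open>Explicit Euler steps\<close>

text \<open>
  Only at these points can the field be integrated in time. They have full measure, so they are
  dense, which suffices for placing the nodes of the Euler scheme.
\<close>
definition measurable_nodes :: "'a set" where
  "measurable_nodes = {z. (\<lambda>t. b t z) \<in> borel_measurable (lebesgue_on {0..T})}"

lemma measurable_nodes_dense:
  assumes "d > 0"
  shows "\<exists>z\<in>measurable_nodes. dist z x < d"
proof (rule ccontr)
  assume "\<not> ?thesis"
  then have sub: "ball x d \<subseteq> {z. z \<notin> measurable_nodes}" by (auto simp: dist_commute)
  from sections obtain N where N: "N \<in> null_sets lborel" "{z. z \<notin> measurable_nodes} \<subseteq> N"
    by (auto simp: eventually_ae_filter measurable_nodes_def)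
  then have "negligible N" by (simp add: negligible_iff_null_sets null_sets_completionI)
  then have "negligible (ball x d)" using sub N(2) negligible_subset by blast
  then show False using \<open>d > 0\<close> open_not_negligible[of "ball x d"] by simp
qed

lemma node_integrable:
  assumes z: "z \<in> measurable_nodes" and pq: "0 \<le> p" "p \<le> q" "q \<le> T"
  shows "(\<lambda>t. b t z) absolutely_integrable_on {p..q}"
    and "norm (integral {p..q} (\<lambda>t. b t z)) \<le> (cumC q - cumC p) * (1 + norm z)"
proof -
  have "(\<lambda>t. b t z) absolutely_integrable_on {0..T}"
  proof (rule measurable_bounded_by_integrable_imp_absolutely_integrable)
    show "(\<lambda>t. b t z) \<in> borel_measurable (lebesgue_on {0..T})" using z by (simp add: measurable_nodes_def)
    show "(\<lambda>t. C t * (1 + norm z)) integrable_on {0..T}" by (intro integrable_on_mult_left C_integrable)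
  qed (use growth in auto)
  then show abs: "(\<lambda>t. b t z) absolutely_integrable_on {p..q}"
    by (rule absolutely_integrable_on_subinterval) (use pq in auto)
  have "norm (integral {p..q} (\<lambda>t. b t z)) \<le> integral {p..q} (\<lambda>t. C t * (1 + norm z))"
    using cumC_diff(1)[OF pq] growth pq abs
    by (intro integral_norm_bound_integral integrable_on_mult_left) (auto simp: absolutely_integrable_on_def)
  then show "norm (integral {p..q} (\<lambda>t. b t z)) \<le> (cumC q - cumC p) * (1 + norm z)"
    using cumC_diff(2)[OF pq] by simp
qed

text \<open>
  The step goes backward in time, from \<open>v\<close> to \<open>u\<close>, with velocity \<open>\<Sum>z\<in>Z. w z x *\<^sub>R b r z\<close> at time \<open>r\<close>.
\<close>
definition euler_step :: "'a set \<Rightarrow> ('a \<Rightarrow> 'a \<Rightarrow> real) \<Rightarrow> real \<Rightarrow> real \<Rightarrow> 'a \<Rightarrow> 'a" where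
  "euler_step Z w u v x = x - (\<Sum>z\<in>Z. w z x *\<^sub>R integral {u..v} (\<lambda>t. b t z))"

lemma euler_step_homeomorphism:
  assumes Z: "finite Z" "Z \<subseteq> measurable_nodes" and uv: "0 \<le> u" "u \<le> v" "v \<le> T" and "0 \<le> L"
    and lip: "\<And>z x x'. z \<in> Z \<Longrightarrow> \<bar>w z x - w z x'\<bar> \<le> L * dist x x'"
    and small: "(cumC v - cumC u) * (L * (\<Sum>z\<in>Z. 1 + norm z)) \<le> 1/2"
  obtains g' where "homeomorphism UNIV UNIV (euler_step Z w u v) g'"
proof -
  let ?k = "\<lambda>x. \<Sum>z\<in>Z. w z x *\<^sub>R integral {u..v} (\<lambda>t. b t z)"
  have "dist (?k x) (?k y) \<le> 1/2 * dist x y" for x y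
  proof -
    have "dist (?k x) (?k y) = norm (\<Sum>z\<in>Z. (w z x - w z y) *\<^sub>R integral {u..v} (\<lambda>t. b t z))"
      by (simp add: dist_norm sum_subtractf scaleR_left_diff_distrib)
    also have "\<dots> \<le> (\<Sum>z\<in>Z. (L * dist x y) * ((cumC v - cumC u) * (1 + norm z)))"
    proof (rule sum_norm_le)
      fix z assume "z \<in> Z"
      then show "norm ((w z x - w z y) *\<^sub>R integral {u..v} (\<lambda>t. b t z)) \<le> (L * dist x y) * ((cumC v - cumC u) * (1 + norm z))"
        using lip[of z x y] node_integrable(2)[OF _ uv, of z] Z(2) \<open>0 \<le> L\<close> unfolding norm_scaleR real_norm_def
        by (intro mult_mono) auto
    qed
    also have "\<dots> = ((cumC v - cumC u) * (L * (\<Sum>z\<in>Z. 1 + norm z))) * dist x y"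
      by (simp add: sum_distrib_left[symmetric])
    also have "\<dots> \<le> 1/2 * dist x y" using small by (intro mult_right_mono) auto
    finally show ?thesis .
  qed
  from homeomorphism_minus_contraction[of ?k, OF this] show thesis using that
    by (auto simp: euler_step_def[abs_def])
qed

lemma weighted_node_integral_bound:
  assumes Z: "Z \<subseteq> measurable_nodes" and pq: "0 \<le> p" "p \<le> q" "q \<le> T"
    and w: "\<And>z. 0 \<le> w z x" "\<And>z. 0 < w z x \<Longrightarrow> dist x z < 1" "(\<Sum>z\<in>Z. w z x) \<le> 1"
  shows "norm (\<Sum>z\<in>Z. w z x *\<^sub>R integral {p..q} (\<lambda>t. b t z)) \<le> (cumC q - cumC p) * (2 + norm x)"
proof -
  have "norm (\<Sum>z\<in>Z. w z x *\<^sub>R integral {p..q} (\<lambda>t. b t z)) \<le> (\<Sum>z\<in>Z. w z x * ((cumC q - cumC p) * (2 + norm x)))"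
  proof (rule sum_norm_le)
    fix z assume "z \<in> Z"
    show "norm (w z x *\<^sub>R integral {p..q} (\<lambda>t. b t z)) \<le> w z x * ((cumC q - cumC p) * (2 + norm x))"
    proof (cases "w z x = 0")
      case False
      then have "dist x z < 1" using w(1,2)[of z] by simp
      then have "norm z \<le> 1 + norm x"
        using norm_triangle_ineq3[of x z] by (simp add: dist_norm)
      then have "(cumC q - cumC p) * (1 + norm z) \<le> (cumC q - cumC p) * (2 + norm x)"
        using cumC_mono[OF pq] by (intro mult_left_mono) auto
      then have "norm (integral {p..q} (\<lambda>t. b t z)) \<le> (cumC q - cumC p) * (2 + norm x)"
        using node_integrable(2)[OF _ pq, of z] Z \<open>z \<in> Z\<close> by auto
      then show ?thesis using w(1)[of z] by (auto intro: mult_left_mono)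
    qed simp
  qed
  also have "\<dots> = (\<Sum>z\<in>Z. w z x) * ((cumC q - cumC p) * (2 + norm x))" by (simp add: sum_distrib_right)
  also have "\<dots> \<le> 1 * ((cumC q - cumC p) * (2 + norm x))"
    using w(3) cumC_mono[OF pq] by (intro mult_right_mono) auto
  finally show ?thesis by simp
qed

lemma euler_step_growth:
  assumes Z: "Z \<subseteq> measurable_nodes" and uv: "0 \<le> u" "u \<le> v" "v \<le> T"
    and w: "\<And>z. 0 \<le> w z x" "\<And>z. 0 < w z x \<Longrightarrow> dist x z < 1" "(\<Sum>z\<in>Z. w z x) \<le> 1"
  shows "2 + norm (euler_step Z w u v x) \<le> exp (cumC v - cumC u) * (2 + norm x)"
proof -
  have "norm (euler_step Z w u v x) \<le> norm x + (cumC v - cumC u) * (2 + norm x)"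
    unfolding euler_step_def using weighted_node_integral_bound[where w = w, OF Z uv w] norm_triangle_ineq4 order_trans add_left_mono
    by (smt (verit))
  then have "2 + norm (euler_step Z w u v x) \<le> (1 + (cumC v - cumC u)) * (2 + norm x)" by (simp add: algebra_simps)
  also have "\<dots> \<le> exp (cumC v - cumC u) * (2 + norm x)" by (intro mult_right_mono exp_ge_add_one_self) auto
  finally show ?thesis .
qed

text \<open>
  Here \<open>c\<close> is a point of the exact curve with velocity \<open>v\<close>, \<open>y\<close> the point of the Euler curve at
  the same time, and \<open>z\<close> a node. The one-sided condition applies to the pair \<open>c\<close>, \<open>z\<close>; replacing
  \<open>z\<close> by \<open>y\<close> on both sides produces errors that vanish with \<open>\<rho>\<close>.
\<close>
lemma one_sided_estimate:
  assumes r: "r \<in> {0..T}" and v: "v \<in> admissible r c" and z: "norm (y - z) \<le> \<rho>"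
    and R: "1 + norm c \<le> R" "1 + norm z \<le> R"
  shows "- (2 * C r * ((norm (c - y))\<^sup>2 + (\<rho>\<^sup>2 + R * \<rho>))) \<le> (c - y) \<bullet> (v - b r z)"
proof -
  have C: "0 \<le> C r" using C_nonneg[OF r] .
  have "\<rho> \<ge> 0" using z norm_ge_zero order_trans by blast
  have "norm (c - z) \<le> norm (c - y) + \<rho>" using z norm_triangle_ineq[of "c - y" "y - z"] by simp
  then have "(norm (c - z))\<^sup>2 \<le> (norm (c - y) + \<rho>)\<^sup>2" by (intro power_mono) auto
  also have "\<dots> \<le> 2 * ((norm (c - y))\<^sup>2 + \<rho>\<^sup>2)"
    using zero_le_power2[of "norm (c - y) - \<rho>"] by (simp add: power2_eq_square algebra_simps)
  finally have "C r * (norm (c - z))\<^sup>2 \<le> C r * (2 * ((norm (c - y))\<^sup>2 + \<rho>\<^sup>2))"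
    using C by (rule mult_left_mono)
  moreover have "- (C r * (norm (c - z))\<^sup>2) \<le> (v - b r z) \<bullet> (c - z)"
    using v by (simp add: admissible_def)
  ultimately have 1: "- (C r * (2 * ((norm (c - y))\<^sup>2 + \<rho>\<^sup>2))) \<le> (v - b r z) \<bullet> (c - z)"
    by linarith
  have "norm (v - b r z) \<le> C r * (1 + norm c) + C r * (1 + norm z)"
    using v growth[OF r, of z] norm_triangle_ineq4[of v "b r z"] by (simp add: admissible_def)
  also have "\<dots> \<le> C r * R + C r * R" using R C by (intro add_mono mult_left_mono)
  finally have "norm (z - y) * norm (v - b r z) \<le> \<rho> * (2 * C r * R)"
    using z \<open>\<rho> \<ge> 0\<close> by (intro mult_mono) (auto simp: norm_minus_commute mult_ac)
  then have 2: "- (\<rho> * (2 * C r * R)) \<le> (z - y) \<bullet> (v - b r z)"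
    using Cauchy_Schwarz_ineq2[of "z - y" "v - b r z"] by linarith
  have "(c - y) \<bullet> (v - b r z) = (v - b r z) \<bullet> (c - z) + (z - y) \<bullet> (v - b r z)"
    by (simp add: inner_commute inner_diff_left inner_diff_right)
  then show ?thesis using 1 2 by (simp add: algebra_simps)
qed

text \<open>
  The difference \<open>D\<close> between the curve and the interpolated Euler curve satisfies, up to the error
  \<open>\<kappa>\<close>, a one-sided inequality for \<open>D \<bullet> h\<close>, where \<open>h\<close> is the difference of the velocities: it is an
  average over the nodes of the inequalities in \<open>one_sided_estimate\<close>. The energy inequality and
  Gronwall then bound the growth of \<open>(norm D)\<^sup>2 + \<kappa>\<close>. Adding \<open>\<kappa>\<close> on both sides makes the estimate
  purely multiplicative, so that it composes over consecutive steps.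
\<close>
lemma euler_step_error:
  assumes Z: "finite Z" "Z \<subseteq> measurable_nodes" and uv: "0 \<le> u" "u \<le> v" "v \<le> T" and "e \<le> 1"
    and w: "\<And>z. 0 \<le> w z x" "\<And>z. 0 < w z x \<Longrightarrow> dist x z < e" "(\<Sum>z\<in>Z. w z x) = 1"
    and R: "2 + norm x \<le> R" "\<And>r. r \<in> {u..v} \<Longrightarrow> 1 + norm (\<gamma> r) \<le> R" and \<gamma>: "integral_curve u v \<gamma>"
    and \<rho>: "e + (cumC v - cumC u) * R \<le> \<rho>" "\<rho>\<^sup>2 + R * \<rho> \<le> \<kappa>"
  shows "(norm (\<gamma> u - euler_step Z w u v x))\<^sup>2 + \<kappa> \<le> exp (8 * (cumC v - cumC u)) * ((norm (\<gamma> v - x))\<^sup>2 + \<kappa>)"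
proof -
  have w1: "dist x z < 1" if "0 < w z x" for z using w(2)[OF that] \<open>e \<le> 1\<close> by simp
  obtain \<gamma>' where \<gamma>': "\<And>p q. u \<le> p \<Longrightarrow> p \<le> q \<Longrightarrow> q \<le> v \<Longrightarrow> (\<gamma>' has_integral (\<gamma> q - \<gamma> p)) {p..q}"
    "\<And>r. r \<in> {u..v} \<Longrightarrow> \<gamma>' r \<in> admissible r (\<gamma> r)"
    using \<gamma> unfolding integral_curve_def by metis
  define \<beta> where "\<beta> r = (\<Sum>z\<in>Z. w z x *\<^sub>R b r z)" for r
  define y where "y r = euler_step Z w r v x" for r
  define D where "D r = \<gamma> r - y r" for r
  define h where "h r = \<gamma>' r - \<beta> r" for r
  have yv: "y v = x" by (simp add: y_def euler_step_def)
  have \<beta>: "(\<beta> has_integral (y q - y p)) {p..q}" if pq: "u \<le> p" "p \<le> q" "q \<le> v" for p q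
  proof -
    have "y q - y p = (\<Sum>z\<in>Z. w z x *\<^sub>R integral {p..q} (\<lambda>t. b t z))"
    proof -
      have "integral {p..v} (\<lambda>t. b t z) - integral {q..v} (\<lambda>t. b t z) = integral {p..q} (\<lambda>t. b t z)" if "z \<in> Z" for z
      proof -
        have "(\<lambda>t. b t z) integrable_on {p..v}"
          using node_integrable(1)[of z p v] Z that pq uv by (auto simp: absolutely_integrable_on_def)
        then show ?thesis
          using Henstock_Kurzweil_Integration.integral_combine[of p q v "\<lambda>t. b t z"] pq by (simp add: algebra_simps)
      qed
      then show ?thesis
        by (simp add: y_def euler_step_def sum_subtractf[symmetric] scaleR_diff_right[symmetric])
    qed
    moreover have "(\<beta> has_integral (\<Sum>z\<in>Z. w z x *\<^sub>R integral {p..q} (\<lambda>t. b t z))) {p..q}"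
      unfolding \<beta>_def
    proof (intro has_integral_sum Z(1) has_integral_cmul)
      fix z assume "z \<in> Z"
      then show "((\<lambda>t. b t z) has_integral integral {p..q} (\<lambda>t. b t z)) {p..q}"
        using node_integrable(1)[of z p q] Z pq uv by (auto simp: absolutely_integrable_on_def)
    qed
    ultimately show ?thesis by simp
  qed
  have D: "(h has_integral (D q - D p)) {p..q}" if "u \<le> p" "p \<le> q" "q \<le> v" for p q
    using has_integral_diff[OF \<gamma>'(1)[OF that] \<beta>[OF that]] by (simp add: h_def[abs_def] D_def algebra_simps)
  have bR: "1 + norm z \<le> R" if "0 < w z x" for z
    using w1[OF that] R(1) norm_triangle_ineq3[of x z] by (simp add: dist_norm)
  have \<beta>R: "norm (\<beta> r) \<le> C r * R" if r: "r \<in> {u..v}" for r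
  proof -
    have "norm (\<beta> r) \<le> (\<Sum>z\<in>Z. w z x * (C r * R))"
      unfolding \<beta>_def
    proof (rule sum_norm_le)
      fix z assume "z \<in> Z"
      show "norm (w z x *\<^sub>R b r z) \<le> w z x * (C r * R)"
      proof (cases "w z x = 0")
        case False
        then have "0 < w z x" using w(1)[of z] by simp
        have "norm (b r z) \<le> C r * (1 + norm z)" using growth[of r z] r uv by auto
        also have "\<dots> \<le> C r * R" using bR[OF \<open>0 < w z x\<close>] C_nonneg[of r] r uv by (intro mult_left_mono) auto
        finally show ?thesis using w(1)[of z] by (auto intro: mult_left_mono)
      qed simp
    qed
    also have "\<dots> = C r * R" using w(3) by (simp add: sum_distrib_right[symmetric])
    finally show ?thesis .
  qed
  have h_abs: "h absolutely_integrable_on {u..v}"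
  proof (rule absolutely_integrable_integrable_bound)
    show "h integrable_on {u..v}" using D[of u v] uv by auto
    show "(\<lambda>r. C r * (2 * R)) integrable_on {u..v}" using cumC_diff(1)[OF uv] by (rule integrable_on_mult_left)
    fix r assume r: "r \<in> {u..v}"
    have "norm (\<gamma>' r) \<le> C r * (1 + norm (\<gamma> r))" using \<gamma>'(2)[OF r] by (simp add: admissible_def)
    also have "\<dots> \<le> C r * R" using R(2)[OF r] C_nonneg[of r] r uv by (intro mult_left_mono) auto
    finally show "norm (h r) \<le> C r * (2 * R)"
      using \<beta>R[OF r] norm_triangle_ineq4[of "\<gamma>' r" "\<beta> r"] by (simp add: h_def)
  qed
  have near: "norm (y r - z) \<le> \<rho>" if r: "r \<in> {u..v}" and z: "0 < w z x" for r z
  proof -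
    have rv: "0 \<le> r" "r \<le> v" using r uv by auto
    have "norm (y r - x) \<le> (cumC v - cumC r) * (2 + norm x)"
      using weighted_node_integral_bound[where w = w, OF Z(2) rv uv(3) w(1) w1] w(3) by (simp add: y_def euler_step_def)
    also have "\<dots> \<le> (cumC v - cumC u) * R" using R(1) cumC_mono[of u r] cumC_mono[of r v] r uv by (intro mult_mono) auto
    finally have "norm (y r - z) \<le> (cumC v - cumC u) * R + e"
      using w(2)[OF z] norm_triangle_ineq[of "y r - x" "x - z"] by (simp add: dist_norm)
    then show ?thesis using \<rho>(1) by simp
  qed
  have "R \<ge> 0" "e > 0"
  proof -
    show "R \<ge> 0" using R(1) norm_ge_zero[of x] by linarith
    have "\<exists>z\<in>Z. w z x \<noteq> 0" using w(3) by (metis sum.neutral zero_neq_one)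
    then show "e > 0" using w(1,2) by (metis dist_pos_lt dual_order.strict_trans1 less_eq_real_def zero_le_dist)
  qed
  have "0 \<le> (cumC v - cumC u) * R" using \<open>R \<ge> 0\<close> cumC_mono[OF uv] by simp
  then have "\<rho> \<ge> 0" using \<rho>(1) \<open>e > 0\<close> by linarith
  have "\<kappa> \<ge> 0" using \<rho>(2) \<open>R \<ge> 0\<close> \<open>\<rho> \<ge> 0\<close> by (meson add_nonneg_nonneg mult_nonneg_nonneg order_trans zero_le_power2)
  have Dh: "- (2 * C r * ((norm (D r))\<^sup>2 + \<kappa>)) \<le> D r \<bullet> h r" if r: "r \<in> {u..v}" for r
  proof -
    have rT: "r \<in> {0..T}" using r uv by auto
    let ?m = "- (2 * C r * ((norm (D r))\<^sup>2 + \<kappa>))"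
    have "?m = (\<Sum>z\<in>Z. w z x * ?m)" using w(3) by (simp only: sum_distrib_right[symmetric] mult_1)
    also have "\<dots> \<le> (\<Sum>z\<in>Z. w z x * (D r \<bullet> (\<gamma>' r - b r z)))"
    proof (rule sum_mono)
      fix z assume "z \<in> Z"
      show "w z x * ?m \<le> w z x * (D r \<bullet> (\<gamma>' r - b r z))"
      proof (cases "w z x = 0")
        case False
        then have z: "0 < w z x" using w(1)[of z] by simp
        have "2 * C r * ((norm (D r))\<^sup>2 + (\<rho>\<^sup>2 + R * \<rho>)) \<le> 2 * C r * ((norm (D r))\<^sup>2 + \<kappa>)"
          using \<rho>(2) C_nonneg[OF rT] by (intro mult_left_mono) auto
        then have "?m \<le> D r \<bullet> (\<gamma>' r - b r z)"
          using one_sided_estimate[OF rT \<gamma>'(2)[OF r] near[OF r z] R(2)[OF r] bR[OF z]] by (simp add: D_def)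
        then show ?thesis using w(1)[of z] by (intro mult_left_mono) auto
      qed simp
    qed
    also have "\<dots> = D r \<bullet> (\<Sum>z\<in>Z. w z x *\<^sub>R (\<gamma>' r - b r z))"
      by (simp add: inner_sum_right)
    also have "(\<Sum>z\<in>Z. w z x *\<^sub>R (\<gamma>' r - b r z)) = h r"
      using w(3) by (simp add: h_def \<beta>_def scaleR_diff_right sum_subtractf scaleR_left.sum[symmetric])
    finally show ?thesis .
  qed
  have "(norm (D u))\<^sup>2 + \<kappa> \<le> exp (2 * (4 * cumC v - 4 * cumC u)) * ((norm (D v))\<^sup>2 + \<kappa>)"
  proof (rule gronwall_backward[where w = "\<lambda>r. (norm (D r))\<^sup>2 + \<kappa>" and A = "\<lambda>r. 4 * cumC r", OF uv(2)])
    have "continuous_on {u..v} D" using uv(2) D by (rule has_integral_increments_continuous_on)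
    then show "continuous_on {u..v} (\<lambda>r. (norm (D r))\<^sup>2 + \<kappa>)" by (intro continuous_intros)
    have "continuous_on {u..v} cumC" using cumC_continuous by (rule continuous_on_subset) (use uv in auto)
    then show "continuous_on {u..v} (\<lambda>r. 4 * cumC r)" by (intro continuous_intros)
    show "mono_on {u..v} (\<lambda>r. 4 * cumC r)" using cumC_mono uv by (auto intro!: mono_onI)
    show "0 \<le> (norm (D r))\<^sup>2 + \<kappa>" for r using \<open>\<kappa> \<ge> 0\<close> by simp
    fix p q M assume pq: "u \<le> p" "p \<le> q" "q \<le> v" and M: "\<And>r. r \<in> {p..q} \<Longrightarrow> (norm (D r))\<^sup>2 + \<kappa> \<le> M"
    have pqT: "0 \<le> p" "p \<le> q" "q \<le> T" using pq uv by auto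
    have "(norm (D p))\<^sup>2 \<le> (norm (D q))\<^sup>2 + 2 * integral {p..q} (\<lambda>r. C r * (2 * M))"
    proof (rule energy_inequality[where h = h])
      show "(h has_integral (D q' - D p')) {p'..q'}" if "p \<le> p'" "p' \<le> q'" "q' \<le> q" for p' q'
        using that pq by (intro D) auto
      show "h absolutely_integrable_on {p..q}"
        using h_abs by (rule absolutely_integrable_on_subinterval) (use pq in auto)
      show "(\<lambda>r. C r * (2 * M)) integrable_on {p..q}" using cumC_diff(1)[OF pqT] by (rule integrable_on_mult_left)
      fix r assume r: "r \<in> {p..q}"
      have "2 * C r * ((norm (D r))\<^sup>2 + \<kappa>) \<le> 2 * C r * M"
        using M[OF r] C_nonneg[of r] r pqT by (intro mult_left_mono) auto
      then show "- (C r * (2 * M)) \<le> D r \<bullet> h r" using Dh[of r] r pq by (simp add: algebra_simps)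
    qed fact
    then show "(norm (D p))\<^sup>2 + \<kappa> \<le> (norm (D q))\<^sup>2 + \<kappa> + M * (4 * cumC q - 4 * cumC p)"
      using cumC_diff(2)[OF pqT] by (simp add: algebra_simps)
  qed
  moreover have "2 * (4 * cumC v - 4 * cumC u) = 8 * (cumC v - cumC u)" by simp
  ultimately show ?thesis by (simp add: D_def yv) (simp add: y_def)
qed

section \<open>Approximation of the flow\<close>

text \<open>
  All steps share the nodes and weights chosen for the tolerance \<open>\<kappa>\<close>, and a step is short enough
  once \<open>cumC\<close> grows by at most \<open>a\<close> during it. The existence of \<open>g\<close> with the growth and error bounds
  passes from two adjacent intervals to their union by composition, so it holds on \<open>{t..s}\<close> if it
  holds on all short intervals around each time. The growth bound is carried along to ensure that
  the Euler curves stay in the ball of radius \<open>R'\<close>, where the weights add up to one.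
\<close>
lemma homeomorphic_approximation:
  assumes ts: "0 \<le> t" "t \<le> s" "s \<le> T" and "0 \<le> R" "0 < \<kappa>"
  shows "\<exists>g g'. homeomorphism UNIV UNIV g g' \<and>
    (\<forall>x \<gamma>. integral_curve t s \<gamma> \<longrightarrow> norm x \<le> R \<longrightarrow> norm (\<gamma> s) \<le> R \<longrightarrow>
      (norm (\<gamma> t - g x))\<^sup>2 + \<kappa> \<le> exp (8 * (cumC s - cumC t)) * ((norm (\<gamma> s - x))\<^sup>2 + \<kappa>))"
proof -
  define R' where "R' = exp (2 * (cumC s - cumC t)) * (2 + R)"
  have "R' > 0" using \<open>0 \<le> R\<close> by (simp add: R'_def)
  \<comment> \<open>The spatial error \<open>e\<close> and the displacement during a step, also at most \<open>e\<close>, give \<open>\<rho> = 2 * e\<close>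
    in \<open>euler_step_error\<close>, and then \<open>\<rho>\<^sup>2 + R' * \<rho> \<le> \<kappa>\<close>.\<close>
  define e where "e = min 1 (\<kappa> / (2 * (2 + R')))"
  have "2 * e \<le> 2 * (\<kappa> / (2 * (2 + R')))" unfolding e_def by (intro mult_left_mono) auto
  also have "\<dots> = \<kappa> / (2 + R')" using mult_divide_mult_cancel_left[of 2 \<kappa> "2 + R'"] by simp
  finally have e: "e > 0" "e \<le> 1" "2 * e \<le> \<kappa> / (2 + R')"
    using \<open>R' > 0\<close> \<open>0 < \<kappa>\<close> by (auto simp: e_def)
  obtain Z L and w :: "'a \<Rightarrow> 'a \<Rightarrow> real" where Z: "finite Z" "Z \<subseteq> measurable_nodes" and "0 \<le> L"
    and w: "\<And>z x. 0 \<le> w z x" "\<And>z x. 0 < w z x \<Longrightarrow> dist x z < e"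
      "\<And>x. (\<Sum>z\<in>Z. w z x) \<le> 1" "\<And>x. x \<in> cball 0 R' \<Longrightarrow> (\<Sum>z\<in>Z. w z x) = 1"
    and lip: "\<And>z x x'. z \<in> Z \<Longrightarrow> \<bar>w z x - w z x'\<bar> \<le> L * dist x x'"
    using lipschitz_bumps[OF e(1) measurable_nodes_dense, of R'] by metis
  define S where "S = L * (\<Sum>z\<in>Z. 1 + norm z)"
  have "S \<ge> 0" using \<open>0 \<le> L\<close> by (auto simp: S_def intro!: mult_nonneg_nonneg sum_nonneg)
  \<comment> \<open>The first bound limits the displacement in a step, the second makes the step a perturbation of
    the identity by a contraction.\<close>
  define a where "a = min (e / R') (1 / (2 * (S + 1)))"
  have "a > 0" using e(1) \<open>R' > 0\<close> \<open>S \<ge> 0\<close> by (simp add: a_def)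
  define P where "P u v \<longleftrightarrow> (t \<le> u \<and> u \<le> v \<and> v \<le> s \<longrightarrow>
    (\<exists>g g'. homeomorphism UNIV UNIV g g' \<and> (\<forall>x. 2 + norm (g x) \<le> exp (cumC v - cumC u) * (2 + norm x)) \<and>
      (\<forall>x \<gamma>. exp (cumC v - cumC t) * (2 + norm x) \<le> R' \<longrightarrow> integral_curve u v \<gamma> \<longrightarrow> (\<forall>r\<in>{u..v}. 1 + norm (\<gamma> r) \<le> R') \<longrightarrow>
        (norm (\<gamma> u - g x))\<^sup>2 + \<kappa> \<le> exp (8 * (cumC v - cumC u)) * ((norm (\<gamma> v - x))\<^sup>2 + \<kappa>))))" for u v
  have "P t s" using ts(2)
  proof (induction rule: Bolzano)
    case (trans p q r)
    show ?case unfolding P_def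
    proof
      assume pr: "t \<le> p \<and> p \<le> r \<and> r \<le> s"
      from trans pr obtain g1 g1' where g1: "homeomorphism UNIV UNIV g1 g1'"
        "\<And>x. 2 + norm (g1 x) \<le> exp (cumC q - cumC p) * (2 + norm x)"
        "\<And>x \<gamma>. exp (cumC q - cumC t) * (2 + norm x) \<le> R' \<Longrightarrow> integral_curve p q \<gamma> \<Longrightarrow> \<forall>r\<in>{p..q}. 1 + norm (\<gamma> r) \<le> R' \<Longrightarrow>
          (norm (\<gamma> p - g1 x))\<^sup>2 + \<kappa> \<le> exp (8 * (cumC q - cumC p)) * ((norm (\<gamma> q - x))\<^sup>2 + \<kappa>)"
        unfolding P_def by auto
      from trans pr obtain g2 g2' where g2: "homeomorphism UNIV UNIV g2 g2'"
        "\<And>x. 2 + norm (g2 x) \<le> exp (cumC r - cumC q) * (2 + norm x)"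
        "\<And>x \<gamma>. exp (cumC r - cumC t) * (2 + norm x) \<le> R' \<Longrightarrow> integral_curve q r \<gamma> \<Longrightarrow> \<forall>r\<in>{q..r}. 1 + norm (\<gamma> r) \<le> R' \<Longrightarrow>
          (norm (\<gamma> q - g2 x))\<^sup>2 + \<kappa> \<le> exp (8 * (cumC r - cumC q)) * ((norm (\<gamma> r - x))\<^sup>2 + \<kappa>)"
        unfolding P_def by auto
      have growth12: "exp c * (2 + norm (g2 x)) \<le> exp (c + (cumC r - cumC q)) * (2 + norm x)" for x c
        using mult_left_mono[OF g2(2)[of x], of "exp c"] by (simp add: exp_add mult.assoc)
      show "\<exists>g g'. homeomorphism UNIV UNIV g g' \<and> (\<forall>x. 2 + norm (g x) \<le> exp (cumC r - cumC p) * (2 + norm x)) \<and>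
        (\<forall>x \<gamma>. exp (cumC r - cumC t) * (2 + norm x) \<le> R' \<longrightarrow> integral_curve p r \<gamma> \<longrightarrow> (\<forall>r\<in>{p..r}. 1 + norm (\<gamma> r) \<le> R') \<longrightarrow>
        (norm (\<gamma> p - g x))\<^sup>2 + \<kappa> \<le> exp (8 * (cumC r - cumC p)) * ((norm (\<gamma> r - x))\<^sup>2 + \<kappa>))"
      proof (rule exI[of _ "g1 \<circ> g2"], rule exI[of _ "g2' \<circ> g1'"], intro conjI allI impI)
        show "homeomorphism UNIV UNIV (g1 \<circ> g2) (g2' \<circ> g1')"
          using g2(1) g1(1) by (rule homeomorphism_compose)
        show "2 + norm ((g1 \<circ> g2) x) \<le> exp (cumC r - cumC p) * (2 + norm x)" for x
          using order_trans[OF g1(2)[of "g2 x"] growth12[of "cumC q - cumC p" x]] by (simp add: algebra_simps)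
        fix x :: 'a and \<gamma> assume x: "exp (cumC r - cumC t) * (2 + norm x) \<le> R'" and \<gamma>: "integral_curve p r \<gamma>"
          and bd: "\<forall>r\<in>{p..r}. 1 + norm (\<gamma> r) \<le> R'"
        have \<gamma>12: "integral_curve p q \<gamma>" "integral_curve q r \<gamma>"
          using integral_curve_subinterval[OF \<gamma>] trans by auto
        have "exp (cumC q - cumC t) * (2 + norm (g2 x)) \<le> R'"
          using growth12[of "cumC q - cumC t" x] x by (simp add: algebra_simps)
        then have "(norm (\<gamma> p - g1 (g2 x)))\<^sup>2 + \<kappa> \<le> exp (8 * (cumC q - cumC p)) * ((norm (\<gamma> q - g2 x))\<^sup>2 + \<kappa>)"
          using \<gamma>12 bd trans by (intro g1(3)) auto
        also have "\<dots> \<le> exp (8 * (cumC q - cumC p)) * (exp (8 * (cumC r - cumC q)) * ((norm (\<gamma> r - x))\<^sup>2 + \<kappa>))"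
          using \<gamma>12 bd trans x by (intro mult_left_mono g2(3)) auto
        also have "\<dots> = exp (8 * (cumC r - cumC p)) * ((norm (\<gamma> r - x))\<^sup>2 + \<kappa>)"
          by (simp add: mult.assoc[symmetric] exp_add[symmetric])
        finally show "(norm (\<gamma> p - (g1 \<circ> g2) x))\<^sup>2 + \<kappa> \<le> exp (8 * (cumC r - cumC p)) * ((norm (\<gamma> r - x))\<^sup>2 + \<kappa>)" by simp
      qed
    qed
  next
    case (local x0)
    then have "x0 \<in> {0..T}" using ts by auto
    then obtain d where "d > 0" and d: "\<And>r. r \<in> {0..T} \<Longrightarrow> dist r x0 < d \<Longrightarrow> dist (cumC r) (cumC x0) < a / 2"
      using cumC_continuous[unfolded continuous_on_iff, rule_format, of x0 "a / 2"] \<open>a > 0\<close> by auto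
    show ?case unfolding P_def
    proof (intro exI[of _ d] conjI allI impI \<open>d > 0\<close>)
      fix u v assume x0: "u \<le> x0 \<and> x0 \<le> v \<and> v - u < d" and "t \<le> u \<and> u \<le> v \<and> v \<le> s"
      then have uv: "0 \<le> u" "u \<le> v" "v \<le> T" and tv: "t \<le> v" using ts by auto
      have "dist (cumC u) (cumC x0) < a / 2" "dist (cumC v) (cumC x0) < a / 2"
        using x0 uv by (intro d; simp add: dist_real_def)+
      then have small: "cumC v - cumC u \<le> a" unfolding dist_real_def abs_less_iff by linarith
      have "(cumC v - cumC u) * S \<le> a * (S + 1)"
        using small cumC_mono[OF uv] \<open>S \<ge> 0\<close> by (intro mult_mono) auto
      also have "\<dots> \<le> (1 / (2 * (S + 1))) * (S + 1)"
        using \<open>S \<ge> 0\<close> by (intro mult_right_mono) (auto simp: a_def)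
      also have "\<dots> = 1/2" using \<open>S \<ge> 0\<close> by simp
      finally have "(cumC v - cumC u) * S \<le> 1/2" .
      then obtain g' where g': "homeomorphism UNIV UNIV (euler_step Z w u v) g'"
        using euler_step_homeomorphism[where w = w, OF Z uv \<open>0 \<le> L\<close> lip] unfolding S_def by blast
      show "\<exists>g g'. homeomorphism UNIV UNIV g g' \<and> (\<forall>x. 2 + norm (g x) \<le> exp (cumC v - cumC u) * (2 + norm x)) \<and>
        (\<forall>x \<gamma>. exp (cumC v - cumC t) * (2 + norm x) \<le> R' \<longrightarrow> integral_curve u v \<gamma> \<longrightarrow> (\<forall>r\<in>{u..v}. 1 + norm (\<gamma> r) \<le> R') \<longrightarrow>
          (norm (\<gamma> u - g x))\<^sup>2 + \<kappa> \<le> exp (8 * (cumC v - cumC u)) * ((norm (\<gamma> v - x))\<^sup>2 + \<kappa>))"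
      proof (rule exI[of _ "euler_step Z w u v"], rule exI[of _ g'], intro conjI allI impI g')
        have w1: "dist x z < 1" if "0 < w z x" for x z using w(2)[OF that] e(2) by simp
        show "2 + norm (euler_step Z w u v x) \<le> exp (cumC v - cumC u) * (2 + norm x)" for x
          using Z(2) uv w(1) w1 w(3) by (rule euler_step_growth)
        fix x :: 'a and \<gamma> assume x: "exp (cumC v - cumC t) * (2 + norm x) \<le> R'" and \<gamma>: "integral_curve u v \<gamma>"
          and bd: "\<forall>r\<in>{u..v}. 1 + norm (\<gamma> r) \<le> R'"
        have "1 * (2 + norm x) \<le> exp (cumC v - cumC t) * (2 + norm x)"
          using cumC_mono[OF ts(1) tv uv(3)] by (intro mult_right_mono) auto
        then have xR: "2 + norm x \<le> R'" using x by simp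
        show "(norm (\<gamma> u - euler_step Z w u v x))\<^sup>2 + \<kappa> \<le> exp (8 * (cumC v - cumC u)) * ((norm (\<gamma> v - x))\<^sup>2 + \<kappa>)"
        proof (rule euler_step_error[where w = w and \<rho> = "2 * e", OF Z uv e(2) w(1) w(2) w(4) xR _ \<gamma>])
          show "x \<in> cball 0 R'" using xR by simp
          show "1 + norm (\<gamma> r) \<le> R'" if "r \<in> {u..v}" for r using bd that by blast
          have "(cumC v - cumC u) * R' \<le> (e / R') * R'"
            using small \<open>R' > 0\<close> by (intro mult_right_mono) (auto simp: a_def)
          then show "e + (cumC v - cumC u) * R' \<le> 2 * e" using \<open>R' > 0\<close> by simp
          have "(2 * e)\<^sup>2 + R' * (2 * e) = (2 * e) * (2 * e + R')" by (simp add: power2_eq_square algebra_simps)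
          also have "\<dots> \<le> (\<kappa> / (2 + R')) * (2 + R')"
            using e \<open>R' > 0\<close> \<open>0 < \<kappa>\<close> by (intro mult_mono) auto
          also have "\<dots> = \<kappa>" using \<open>R' > 0\<close> by simp
          finally show "(2 * e)\<^sup>2 + R' * (2 * e) \<le> \<kappa>" .
        qed
      qed
    qed
  qed
  then obtain g g' where g: "homeomorphism UNIV UNIV g g'"
    "\<And>x \<gamma>. exp (cumC s - cumC t) * (2 + norm x) \<le> R' \<Longrightarrow> integral_curve t s \<gamma> \<Longrightarrow> \<forall>r\<in>{t..s}. 1 + norm (\<gamma> r) \<le> R' \<Longrightarrow>
       (norm (\<gamma> t - g x))\<^sup>2 + \<kappa> \<le> exp (8 * (cumC s - cumC t)) * ((norm (\<gamma> s - x))\<^sup>2 + \<kappa>)"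
    unfolding P_def using ts(2) by auto
  show ?thesis
  proof (rule exI[of _ g], rule exI[of _ g'], intro conjI allI impI g)
    have As: "cumC t \<le> cumC s" using cumC_mono ts by simp
    fix x :: 'a and \<gamma> assume \<gamma>: "integral_curve t s \<gamma>" and x: "norm x \<le> R" "norm (\<gamma> s) \<le> R"
    show "exp (cumC s - cumC t) * (2 + norm x) \<le> R'"
      unfolding R'_def using x As by (intro mult_mono) auto
    show "\<forall>r\<in>{t..s}. 1 + norm (\<gamma> r) \<le> R'"
    proof
      fix r assume r: "r \<in> {t..s}"
      have "1 + norm (\<gamma> r) \<le> exp (2 * (cumC s - cumC r)) * (1 + norm (\<gamma> s))"
        using integral_curve_growth(1)[of r s \<gamma>] integral_curve_subinterval[OF \<gamma>, of r s] r ts by auto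
      also have "\<dots> \<le> R'"
        unfolding R'_def using x cumC_mono[of t r] r ts by (intro mult_mono) auto
      finally show "1 + norm (\<gamma> r) \<le> R'" .
    qed
  qed
qed

text \<open>
  The square root of \<open>homeomorphic_approximation\<close>, with \<open>\<kappa>\<close> chosen such that the additive error
  becomes \<open>e\<close>.
\<close>
lemma flow_approximation:
  assumes ts: "0 \<le> t" "t \<le> s" "s \<le> T" and flow: "backward_filippov_flow T b \<phi>" and "0 \<le> R" "0 < e"
  shows "\<exists>g g'. homeomorphism UNIV UNIV g g' \<and> (\<forall>x\<in>cball 0 R. \<forall>x'\<in>cball 0 R.
           norm (\<phi> t s x - g x') \<le> exp (4 * (cumC s - cumC t)) * norm (x - x') + e)"
proof -
  let ?L = "exp (4 * (cumC s - cumC t))"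
  have L2: "exp (8 * (cumC s - cumC t)) = ?L\<^sup>2" by (simp add: power2_eq_square exp_add[symmetric])
  obtain g g' where g: "homeomorphism UNIV UNIV g g'"
    "\<And>x \<gamma>. integral_curve t s \<gamma> \<Longrightarrow> norm x \<le> R \<Longrightarrow> norm (\<gamma> s) \<le> R \<Longrightarrow>
       (norm (\<gamma> t - g x))\<^sup>2 + (e / ?L)\<^sup>2 \<le> ?L\<^sup>2 * ((norm (\<gamma> s - x))\<^sup>2 + (e / ?L)\<^sup>2)"
    using homeomorphic_approximation[OF ts \<open>0 \<le> R\<close>, of "(e / ?L)\<^sup>2"] \<open>0 < e\<close> unfolding L2 by auto
  show ?thesis
  proof (rule exI[of _ g], rule exI[of _ g'], intro conjI ballI g)
    fix x x' :: 'a assume x: "x \<in> cball 0 R" "x' \<in> cball 0 R"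
    have sol: "backward_filippov_solution b s x (\<lambda>t. \<phi> t s x)"
      using flow ts by (auto simp: backward_filippov_flow_def)
    then have \<phi>: "\<phi> s s x = x" by (simp add: backward_filippov_solution_def)
    have "integral_curve t s (\<lambda>t. \<phi> t s x)"
      using integral_curve_subinterval[OF integral_curve_filippov_solution[OF _ sol]] ts by auto
    from g(2)[OF this, of x'] x have "(norm (\<phi> t s x - g x'))\<^sup>2 + (e / ?L)\<^sup>2 \<le> ?L\<^sup>2 * ((norm (x - x'))\<^sup>2 + (e / ?L)\<^sup>2)"
      by (simp add: \<phi>)
    then have "(norm (\<phi> t s x - g x'))\<^sup>2 \<le> ?L\<^sup>2 * ((norm (x - x'))\<^sup>2 + (e / ?L)\<^sup>2)"
      using zero_le_power2[of "e / ?L"] by linarith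
    also have "\<dots> \<le> ?L\<^sup>2 * (norm (x - x') + e / ?L)\<^sup>2"
      using \<open>0 < e\<close> by (intro mult_left_mono) (auto simp: power2_sum)
    also have "\<dots> = (?L * norm (x - x') + e)\<^sup>2"
      by (simp add: power_mult_distrib[symmetric] distrib_left)
    finally show "norm (\<phi> t s x - g x') \<le> ?L * norm (x - x') + e"
      by (rule power2_le_imp_le) (use \<open>0 < e\<close> in auto)
  qed
qed

lemma flow_coercive:
  assumes ts: "0 \<le> t" "t \<le> s" "s \<le> T" and flow: "backward_filippov_flow T b \<phi>"
  shows "1 + norm x \<le> exp (2 * (cumC s - cumC t)) * (1 + norm (\<phi> t s x))"
proof -
  have sol: "backward_filippov_solution b s x (\<lambda>t. \<phi> t s x)"
    using flow ts by (auto simp: backward_filippov_flow_def)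
  then have \<phi>: "\<phi> s s x = x" by (simp add: backward_filippov_solution_def)
  have "integral_curve t s (\<lambda>t. \<phi> t s x)"
    using integral_curve_subinterval[OF integral_curve_filippov_solution[OF _ sol]] ts by auto
  from integral_curve_growth(2)[OF this ts] show ?thesis by (simp add: \<phi>)
qed

end

section \<open>The inverse flow\<close>

text \<open>
  Sections of Lebesgue measurable functions need not all be measurable. Each component agrees outside
  a Borel null set with a Borel function, and by Fubini almost every section of that null set is null.
\<close>
lemma AE_section_measurable:
  fixes f :: "real \<times> 'a::euclidean_space \<Rightarrow> 'b::euclidean_space"
  assumes f: "f \<in> borel_measurable (lebesgue_on (S \<times> UNIV))" and S: "S \<in> sets borel"
  shows "AE z in lborel. (\<lambda>t. f (t, z)) \<in> borel_measurable (lebesgue_on S)"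
proof -
  have "S \<times> (UNIV :: 'a set) \<in> sets borel" 
    using S by (simp add: borel_prod[symmetric])
  then have SU: "S \<times> (UNIV :: 'a set) \<in> sets lebesgue" by simp
  have S': "S \<in> sets lebesgue" using S by simp
  define F where "F p = (if p \<in> S \<times> UNIV then f p else 0)" for p
  have F: "F \<in> borel_measurable lebesgue"
    unfolding F_def using borel_measurable_if[OF SU, of f] f by simp
  have comp: "AE z in lborel. (\<lambda>t. F (t, z) \<bullet> k) \<in> borel_measurable lebesgue" for k :: 'b
  proof -
    have "(\<lambda>p. F p \<bullet> k) \<in> borel_measurable lebesgue" using F by simp
    from completion_ex_borel_measurable_real[OF this]
    obtain g where g: "g \<in> borel_measurable lborel" "AE p in lborel. F p \<bullet> k = g p" by auto
    from AE_E[OF g(2)] obtain N where N: "{p \<in> space lborel. \<not> F p \<bullet> k = g p} \<subseteq> N" "emeasure lborel N = 0" "N \<in> sets lborel"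
      by blast
    have "AE p in lborel \<Otimes>\<^sub>M lborel. p \<notin> N"
      unfolding lborel_prod using N by (intro AE_not_in) (auto simp: null_sets_def)
    then have "AE t in lborel. AE z in lborel. (t, z) \<notin> N" by (rule lborel_pair.AE_pair)
    moreover have "{p \<in> space (lborel \<Otimes>\<^sub>M lborel). (fst p, snd p) \<notin> N} \<in> sets (lborel \<Otimes>\<^sub>M lborel)"
      unfolding lborel_prod using N(3) by (simp add: Collect_neg_eq)
    ultimately have "AE z in lborel. AE t in lborel. (t, z) \<notin> N"
      using lborel_pair.AE_commute[of "\<lambda>t z. (t, z) \<notin> N"] by blast
    then show ?thesis
    proof eventually_elim
      case (elim z)
      have "g \<in> borel_measurable (borel \<Otimes>\<^sub>M borel)" using g(1) by (simp add: borel_prod)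
      then have "(\<lambda>t. g (t, z)) \<in> borel_measurable borel" by measurable
      then have "(\<lambda>t. g (t, z)) \<in> borel_measurable lebesgue" by (simp add: measurable_completion)
      moreover have "AE t in lborel. g (t, z) = F (t, z) \<bullet> k"
        using elim by (rule eventually_mono) (use N(1) in \<open>force simp: space_lborel\<close>)
      ultimately show ?case by (rule borel_measurable_AE[OF _ AE_completion])
    qed
  qed
  have "AE z in lborel. \<forall>k\<in>Basis. (\<lambda>t. F (t, z) \<bullet> k) \<in> borel_measurable lebesgue"
    using comp by (intro AE_ball_countable[THEN iffD2]) (auto simp: countable_finite)
  then show ?thesis
  proof eventually_elim
    case (elim z)
    then have "(\<lambda>t. F (t, z)) \<in> borel_measurable lebesgue"
      using borel_measurable_euclidean_space by blast
    moreover have "(\<lambda>t. F (t, z)) = (\<lambda>t. if t \<in> S then f (t, z) else 0)" by (auto simp: F_def)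
    ultimately show ?case using borel_measurable_if[OF S', of "\<lambda>t. f (t, z)"] by simp
  qed
qed

theorem proposition2p2:
  fixes T :: real
    and b :: "real \<Rightarrow> real ^ 'd \<Rightarrow> real ^ 'd"
    and C\<^sub>0 C\<^sub>1 :: "real \<Rightarrow> real"
    and \<phi> :: "real \<Rightarrow> real \<Rightarrow> real ^ 'd \<Rightarrow> real ^ 'd"
  assumes "T > 0"
    and "(\<lambda>(t, x). b t x) \<in> borel_measurable (lebesgue_on ({0..T} \<times> UNIV))"
    and "C\<^sub>0 absolutely_integrable_on {0..T}" and "\<And>t. t \<in> {0..T} \<Longrightarrow> C\<^sub>0 t \<ge> 0"
    and "C\<^sub>1 absolutely_integrable_on {0..T}" and "\<And>t. t \<in> {0..T} \<Longrightarrow> C\<^sub>1 t \<ge> 0"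
    and "\<And>t x. t \<in> {0..T} \<Longrightarrow> norm (b t x) \<le> C\<^sub>0 t * (1 + norm x)"
    and "\<And>t x y. t \<in> {0..T} \<Longrightarrow>
           (b t x - b t y) \<bullet> (x - y) \<ge> - C\<^sub>1 t * (norm (x - y))\<^sup>2"
    and "backward_filippov_flow T b \<phi>"
  shows "\<forall>t s. 0 \<le> t \<and> t \<le> s \<and> s \<le> T \<longrightarrow>
           (\<exists>A \<phi>\<^sub>s\<^sub>t. - A \<in> null_sets lebesgue \<and>
              (\<forall>y\<in>A. \<phi> t s -` {y} = {\<phi>\<^sub>s\<^sub>t y}) \<and>
              (\<exists>\<psi> :: real ^ 'd \<Rightarrow> real ^ 'd.
                 (AE y in lebesgue. \<psi> y = \<phi>\<^sub>s\<^sub>t y) \<and>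
                 (AE y in lebesgue. isCont \<psi> y)))"
proof (intro allI impI)
  fix t s assume "0 \<le> t \<and> t \<le> s \<and> s \<le> T"
  then have ts: "0 \<le> t" "t \<le> s" "s \<le> T" by auto
  interpret one_sided_field T b "\<lambda>t. C\<^sub>0 t + C\<^sub>1 t"
  proof
    show "(\<lambda>t. C\<^sub>0 t + C\<^sub>1 t) integrable_on {0..T}"
      using assms(3,5) by (intro integrable_add) (auto simp: absolutely_integrable_on_def)
    show "AE z in lborel. (\<lambda>t. b t z) \<in> borel_measurable (lebesgue_on {0..T})"
      using AE_section_measurable[OF assms(2)] by simp
  next
    fix t :: real and x y :: "real ^ 'd" assume t: "t \<in> {0..T}"
    show "0 \<le> C\<^sub>0 t + C\<^sub>1 t" using assms(4,6)[OF t] by simp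
    show "norm (b t x) \<le> (C\<^sub>0 t + C\<^sub>1 t) * (1 + norm x)"
      using assms(7)[OF t, of x] mult_nonneg_nonneg[OF assms(6)[OF t], of "1 + norm x"] by (simp add: distrib_right)
    show "- (C\<^sub>0 t + C\<^sub>1 t) * (norm (x - y))\<^sup>2 \<le> (b t x - b t y) \<bullet> (x - y)"
      using assms(8)[OF t, of x y] mult_nonneg_nonneg[OF assms(4)[OF t], of "(norm (x - y))\<^sup>2"] by (simp add: algebra_simps)
  qed
  have coercive: "norm x \<le> exp (2 * (cumC s - cumC t)) * (1 + norm (\<phi> t s x))" for x
    using flow_coercive[OF ts assms(9), of x] by linarith
  obtain G \<psi> where "negligible (- G)" "\<And>y. y \<in> G \<Longrightarrow> \<phi> t s -` {y} = {\<psi> y}" and cont: "\<And>y. y \<in> G \<Longrightarrow> isCont \<psi> y"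
    using ae_continuous_inverse[OF flow_approximation[OF ts assms(9)] coercive] by blast
  moreover from this(1) have null: "- G \<in> null_sets lebesgue" by (simp add: negligible_iff_null_sets)
  moreover have "AE y in lebesgue. isCont \<psi> y"
    by (rule AE_I'[OF null]) (use cont in auto)
  ultimately show "\<exists>A \<phi>\<^sub>s\<^sub>t. - A \<in> null_sets lebesgue \<and> (\<forall>y\<in>A. \<phi> t s -` {y} = {\<phi>\<^sub>s\<^sub>t y}) \<and>
      (\<exists>\<psi>. (AE y in lebesgue. \<psi> y = \<phi>\<^sub>s\<^sub>t y) \<and> (AE y in lebesgue. isCont \<psi> y))"
    by (intro exI[of _ G] exI[of _ \<psi>]) auto
qed

end
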